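(* Let $N\ge 0$. There are countably infinitely many directions $\theta^0$ and countably infinitely many points $x_N^0$ from which to choose an initial condition $(x_N^0,\theta^0)$ of $\Omega(\mathscr{T}_N)$ so that the sequence of compatible orbits $\{\mathscr{O}_n(x_n^0,\theta^0)\}_{n=N}^\infty$ determined by $(x_N^0,\theta^0)$ is a sequence of compatible periodic orbits (of the prefractal billiards $\Omega(\mathscr{T}_n)$) yielding a sequence of basepoints $\{x_n^{k_n}\}_{n=N}^\infty$, with $x_n^{k_n}$ a basepoint of $\mathscr{O}_n(x_n^0,\theta^0)$, that converges to an elusive point of $\Omega(\mathscr{T})$. The basepoints $\{x_n^{k_n}\}_{n=N}^\infty$ constitute the vertices of a nontrivial path of $\Omega(\mathscr{T})$. Moreover, once such a nontrivial path is constructed, letting ${x'}_N^0=x_N^0$, an additional nontrivial path can be determined in exactly the same fashion from a sequence of compatible periodic orbits $\{\mathscr{O}_n({x'}_n^0,\pi-\theta^0)\}_{n=N}^\infty$ (that is, its orbits yield a sequence of basepoints converging to an elusive point of $\Omega(\mathscr{T})$ and constituting the vertices of a nontrivial path).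
   Context: **The T-fractal.** $\mathscr{T}_0$ is the boundary of a T-shaped region made of eight unit squares: a stem $[0,2]\times[0,2]$, on top of which sits the bar $[-1,3]\times[2,3]$. Its base is $[0,2]\times\{0\}$. For $n\ge0$, $\Omega(\mathscr{T}_{n+1})$ is obtained from $\Omega(\mathscr{T}_n)$ by attaching $2^{n+1}$ copies of the T-shape scaled by $2^{-(n+1)}$: on top of the bar of each scaled T-shape added at stage $n$ (for $n=0$, the initial T-shape itself), two such copies are attached, their bases being glued to the leftmost quarter and the rightmost quarter of the top edge of the bar, these base segments being removed from the boundary. $\mathscr{T}_{n+1}$ is the boundary of the resulting region; $\mathscr{T}$ is the limiting closed boundary curve, and $\Omega(\mathscr{T})$ the region it bounds. **Billiards.** In $\Omega(\mathscr{T}_n)$ a point moves at unit speed in straight lines and reflects off sides by the law of reflection; at vertices of interior angle $\pi/2$ reflection is defined (the trajectory comes back along the path on which it arrived), at vertices of interior angle $3\pi/2$ it is not. An initial condition $(x_n^0,\theta_n^0)$ is a boundary point with an inward pointing direction, angles being measured in the fixed coordinate system; $\mathscr{O}_n(x_n^0,\theta_n^0)$ is the resulting orbit, and $x_n^{k_n}$ denotes the basepoint (boundary point) of the $k_n$th iterate of the billiard map $f_n$ of $\Omega(\mathscr{T}_n)$ applied to the initial condition. The orbit is periodic if reflection is well defined at all its basepoints and $f_n^m$ fixes the initial condition for some $m\ge1$. **Compatible orbits.** For $n>m$, initial conditions $(x_n^0,\theta_n^0)$ of $\Omega(\mathscr{T}_n)$ and $(x_m^0,\theta_m^0)$ of $\Omega(\mathscr{T}_m)$,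 both inward pointing, are compatible if $\theta_n^0=\theta_m^0$ and $x_n^0,x_m^0$ lie on a segment in this direction that meets the boundary $\mathscr{T}_n$ only at $x_n^0$. A sequence of compatible orbits is a sequence $\{\mathscr{O}_n(x_n^0,\theta^0)\}_{n=N}^\infty$ whose initial conditions are pairwise compatible; it is determined by its first initial condition. It is a sequence of compatible periodic orbits if every orbit in it is periodic. **Points and paths of the fractal billiard.** A point $z\in\mathscr{T}$ is an elusive point if $z\notin\bigcup_{n=0}^\infty\mathscr{T}_n$. A point $z\in\mathscr{T}$ is a smooth fractal point if there is $N'\ge0$ such that, for every $n\ge N'$, $z\in\mathscr{T}_n$ and $\mathscr{T}_n$ has a well-defined tangent at $z$. A nontrivial path of $\Omega(\mathscr{T})$ is a piecewise linear curve in $\Omega(\mathscr{T})$, each linear segment of which is joined to an endpoint of another segment with the common endpoints lying on $\mathscr{T}$ at smooth fractal points, such that at each point $z$ where the path meets $\mathscr{T}$ the angles formed by the two adjacent segments, relative to the side of $\mathscr{T}_n$ on which $z$ lies ($n$ least with $z\in\mathscr{T}_n$), are equal. *)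

theory Defs
  imports "HOL-Analysis.Analysis"
begin

text \<open>
  The plane is \<^typ>\<open>complex\<close>; a direction angle \<open>\<theta>\<close> is the unit vector \<^term>\<open>cis \<theta>\<close>, so that
  \<open>pi - \<theta>\<close> is the mirror image of \<open>\<theta>\<close> in a vertical axis.
\<close>

section \<open>The T-fractal and its prefractal approximations\<close>

definition tshape0 :: "complex set" where
  "tshape0 = cbox 0 (Complex 2 2) \<union> cbox (Complex (-1) 2) (Complex 3 3)"

text \<open>The T-shape scaled by \<open>s\<close> whose base has left endpoint \<open>a\<close>.\<close>

definition tshape :: "complex \<Rightarrow> real \<Rightarrow> complex set" where
  "tshape a s = (\<lambda>z. a + s *\<^sub>R z) ` tshape0"

text \<open>
  Left endpoints of the bases of the \<open>2 ^ n\<close> T-shapes of scale \<open>(1/2) ^ n\<close> added at stage \<open>n\<close>.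
  In the coordinates of a T-shape the top edge of its bar is \<open>[-1,3] \<times> {3}\<close>; the next two bases
  are \<open>[-1,0] \<times> {3}\<close> and \<open>[2,3] \<times> {3}\<close>.
\<close>

primrec base_points :: "nat \<Rightarrow> complex set" where
  "base_points 0 = {0}"
| "base_points (Suc n) =
     (\<Union>a\<in>base_points n. {a + (1/2) ^ n *\<^sub>R Complex (-1) 3, a + (1/2) ^ n *\<^sub>R Complex 2 3})"

text \<open>
  Since the T-shapes are closed, the open base segments along which they are glued lie in the
  interior of the union, hence not on the boundary curve.
\<close>

definition closed_region :: "nat \<Rightarrow> complex set" where
  "closed_region n = (\<Union>k\<le>n. \<Union>a\<in>base_points k. tshape a ((1/2) ^ k))"

definition prefractal_region :: "nat \<Rightarrow> complex set" where
  "prefractal_region n = interior (closed_region n)"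

definition prefractal :: "nat \<Rightarrow> complex set" where
  "prefractal n = frontier (closed_region n)"

text \<open>
  The fractal curve is the limit of the curves \<^term>\<open>prefractal n\<close>.  The region it bounds is
  the union of the increasing open regions (and not \<^term>\<open>inside T_fractal\<close>: the curve touches
  itself at height 6, where it encloses further bounded components of the complement).
\<close>

definition T_fractal :: "complex set" where
  "T_fractal = {z. \<exists>p. (\<forall>n. p n \<in> prefractal n) \<and> p \<longlonglongrightarrow> z}"

definition T_region :: "complex set" where
  "T_region = (\<Union>n. prefractal_region n)"

section \<open>Prefractal billiards\<close>

text \<open>\<open>d\<close> is a unit tangent vector of the polygonal curve \<open>S\<close> at its non-vertex point \<open>z\<close>.\<close>

definition has_tangent :: "complex set \<Rightarrow> complex \<Rightarrow> complex \<Rightarrow> bool" where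
  "has_tangent S z d \<longleftrightarrow>
     norm d = 1 \<and> (\<exists>e>0. S \<inter> ball z e = {z + s *\<^sub>R d | s. True} \<inter> ball z e)"

text \<open>Vertices of interior angle \<open>pi/2\<close>: locally the region is a quadrant with apex \<open>z\<close>.\<close>

definition right_angle_vertex :: "nat \<Rightarrow> complex \<Rightarrow> bool" where
  "right_angle_vertex n z \<longleftrightarrow>
     (\<exists>d. norm d = 1 \<and> (\<exists>e>0. closed_region n \<inter> ball z e =
        {z + a *\<^sub>R d + b *\<^sub>R (\<i> * d) | a b. 0 \<le> a \<and> 0 \<le> b} \<inter> ball z e))"

text \<open>
  \<open>reflects n z u u'\<close>: arriving at the boundary point \<open>z\<close> with velocity \<open>u\<close>, the point leaves
  with velocity \<open>u'\<close>.  No rule applies at vertices of interior angle \<open>3*pi/2\<close>.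
\<close>

inductive reflects :: "nat \<Rightarrow> complex \<Rightarrow> complex \<Rightarrow> complex \<Rightarrow> bool" for n z u where
  side: "has_tangent (prefractal n) z d \<Longrightarrow> reflects n z u ((2 * (u \<bullet> d)) *\<^sub>R d - u)"
| vertex: "right_angle_vertex n z \<Longrightarrow> reflects n z u (- u)"

text \<open>
  The graph of the (partial) billiard map on pairs of a boundary point and an inward pointing
  unit vector.
\<close>

definition billiard_step :: "nat \<Rightarrow> complex \<times> complex \<Rightarrow> complex \<times> complex \<Rightarrow> bool" where
  "billiard_step n = (\<lambda>(x, u) (x', u').
     (\<exists>t>0. x' = x + t *\<^sub>R u) \<and> open_segment x x' \<subseteq> prefractal_region n \<and>
     x' \<in> prefractal n \<and> reflects n x' u u')"

definition initial_condition :: "nat \<Rightarrow> complex \<Rightarrow> real \<Rightarrow> bool" where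
  "initial_condition n x \<theta> \<longleftrightarrow> x \<in> prefractal n \<and>
     (\<exists>e>0. \<forall>t. 0 < t \<and> t < e \<longrightarrow> x + t *\<^sub>R cis \<theta> \<in> prefractal_region n)"

text \<open>\<open>y\<close> is the basepoint of the \<open>k\<close>th iterate of the billiard map at \<open>(x, \<theta>)\<close>.\<close>

definition is_basepoint :: "nat \<Rightarrow> complex \<Rightarrow> real \<Rightarrow> nat \<Rightarrow> complex \<Rightarrow> bool" where
  "is_basepoint n x \<theta> k y \<longleftrightarrow> (\<exists>u. (billiard_step n ^^ k) (x, cis \<theta>) (y, u))"

text \<open>That reflection is defined at all basepoints is implied: each step includes a reflection.\<close>

definition periodic_orbit :: "nat \<Rightarrow> complex \<Rightarrow> real \<Rightarrow> bool" where
  "periodic_orbit n x \<theta> \<longleftrightarrow> initial_condition n x \<theta> \<and>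
     (\<exists>m\<ge>1. (billiard_step n ^^ m) (x, cis \<theta>) (x, cis \<theta>))"

definition compatible :: "nat \<Rightarrow> complex \<Rightarrow> real \<Rightarrow> nat \<Rightarrow> complex \<Rightarrow> real \<Rightarrow> bool" where
  "compatible n x \<theta> m y \<phi> \<longleftrightarrow> m < n \<and>
     initial_condition n x \<theta> \<and> initial_condition m y \<phi> \<and> \<theta> = \<phi> \<and>
     (\<exists>r\<ge>0. y = x + r *\<^sub>R cis \<theta>) \<and> closed_segment x y \<inter> prefractal n = {x}"

definition compatible_periodic_orbits :: "nat \<Rightarrow> (nat \<Rightarrow> complex) \<Rightarrow> real \<Rightarrow> bool" where
  "compatible_periodic_orbits N x \<theta> \<longleftrightarrow>
     (\<forall>m\<ge>N. \<forall>n>m. compatible n (x n) \<theta> m (x m) \<theta>) \<and> (\<forall>n\<ge>N. periodic_orbit n (x n) \<theta>)"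

section \<open>Points and paths of the fractal billiard\<close>

definition elusive_point :: "complex \<Rightarrow> bool" where
  "elusive_point z \<longleftrightarrow> z \<in> T_fractal \<and> z \<notin> (\<Union>n. prefractal n)"

definition smooth_fractal_point :: "complex \<Rightarrow> bool" where
  "smooth_fractal_point z \<longleftrightarrow> z \<in> T_fractal \<and>
     (\<exists>N'. \<forall>n\<ge>N'. z \<in> prefractal n \<and> (\<exists>d. has_tangent (prefractal n) z d))"

definition angle_between :: "complex \<Rightarrow> complex \<Rightarrow> real" where
  "angle_between u w = arccos ((u \<bullet> w) / (norm u * norm w))"

text \<open>
  Infinite nontrivial path with consecutive vertices \<open>v 0, v 1, \<dots>\<close>.  The path meets the fractal
  curve in its vertices only, the segments between them being in the open region.  The two
  segments at a vertex are measured against the two opposite directions \<open>d\<close>, \<open>- d\<close> of the side,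
  as in the law of reflection.
\<close>

definition nontrivial_path :: "(nat \<Rightarrow> complex) \<Rightarrow> bool" where
  "nontrivial_path v \<longleftrightarrow>
     (\<forall>k. v k \<noteq> v (Suc k)) \<and>
     (\<forall>k. open_segment (v k) (v (Suc k)) \<subseteq> T_region) \<and>
     (\<forall>k. smooth_fractal_point (v k)) \<and>
     (\<forall>k. let z = v (Suc k) in
        \<exists>d. has_tangent (prefractal (LEAST n. z \<in> prefractal n)) z d \<and>
            angle_between (v k - z) d = angle_between (v (Suc (Suc k)) - z) (- d))"

definition path_trace :: "(nat \<Rightarrow> complex) \<Rightarrow> complex set" where
  "path_trace v = (\<Union>k. closed_segment (v k) (v (Suc k)))"

text \<open>
  The initial condition \<open>(x, \<theta>)\<close> of the \<open>N\<close>th billiard determines a sequence of compatible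
  periodic orbits with a sequence of basepoints \<open>v n\<close> (\<open>n \<ge> N\<close>) that converges to an elusive
  point and constitutes the vertices of a nontrivial path.
\<close>

definition yields_nontrivial_path :: "nat \<Rightarrow> complex \<Rightarrow> real \<Rightarrow> (nat \<Rightarrow> complex) \<Rightarrow> bool" where
  "yields_nontrivial_path N x \<theta> v \<longleftrightarrow>
     (\<exists>xs k. xs N = x \<and> compatible_periodic_orbits N xs \<theta> \<and>
        (\<forall>n\<ge>N. is_basepoint n (xs n) \<theta> (k n) (v n))) \<and>
     (\<exists>z. elusive_point z \<and> v \<longlonglongrightarrow> z) \<and>
     nontrivial_path (\<lambda>j. v (N + j))"

end

theory Submission
  imports Defs
begin

text \<open>
  The directions are the \<open>\<theta> = arctan (1 / c)\<close> with \<open>c = 4 * m + 2\<close>, so that the horizontal component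
  of the velocity is \<open>\<plusminus> c\<close> times the vertical one; the starting points are points \<open>(t, 0)\<close> of the base
  of the first T-shape with \<open>t\<close> not dyadic.  Such a point lies on every \<^term>\<open>prefractal n\<close>, so the
  constant sequence of initial conditions is compatible.  Three facts make the theorem true.

  \<^emph>\<open>No corner is ever hit.\<close>  All vertices of \<^term>\<open>prefractal n\<close> have coordinates that are multiples of
  \<open>(1/2) ^ n\<close>.  On a segment with direction \<open>(\<sigma> c, \<rho>)\<close>, where \<open>\<sigma>\<close> and \<open>\<rho>\<close> are signs, the phase
  \<open>x - \<sigma> \<rho> c y\<close> is constant, and a reflection changes it only by a sign and by a multiple of
  \<open>(1/2) ^ n\<close>, because the side lies on a grid line.  Hence it stays in the set of \<open>\<plusminus> t\<close> plus such
  multiples, which contains no grid number, whereas at a vertex it would be one.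

  \<^emph>\<open>All these orbits are periodic\<close> (\<open>off_grid_orbit_periodic\<close>).  One coordinate of a basepoint is on
  the grid and the phase then restricts the other one, so only finitely many pairs of a basepoint
  and a velocity can occur.  The billiard map is defined on all of them and injective.

  \<^emph>\<open>The trajectory climbs\<close> (\<open>next_side\<close>).  While it moves up the stem of a T-shape it cannot meet a
  horizontal side, and it enters the bar somewhere in the middle half.  Unfold the bar, whose width is
  \<open>4\<close> and whose height is \<open>1\<close>: the trajectory advances horizontally by \<open>c\<close>, which is \<open>2\<close> modulo \<open>4\<close>,
  and folding back changes its distance from the left end, modulo \<open>4\<close>, at most by a sign.  Distance less
  than \<open>1\<close> from the middle of the bar thus turns into distance less than \<open>1\<close> from one of its ends:
  the trajectory leaves the bar through an outer quarter of its top, which is the base of a T-shape of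
  the next stage.  So in the fractal region it never meets a horizontal side.

  The successive vertices \<open>v 0, v 1, \<dots>\<close> of this climbing trajectory are the nontrivial path.  The level
  grows by at most one from one vertex to the next, so the first \<open>j\<close> segments lie in
  \<^term>\<open>prefractal_region n\<close> for \<open>n \<ge> j\<close>, and \<open>v (n - N)\<close> is a basepoint of the orbit in every
  \<^term>\<open>prefractal_region n\<close> with \<open>n \<ge> N\<close>.  On the sides of the first \<open>M\<close> levels the abscissas of the
  vertices are multiples of \<open>(1/2) ^ M\<close>, so that each segment between them gains a definite height; hence
  the levels are unbounded, the heights tend to \<open>6\<close>, and the vertices converge to a point of height
  \<open>6\<close>, which lies on no prefractal curve.  The argument is the same for both signs of the horizontal
  velocity, that is, for \<open>\<theta>\<close> and \<open>pi - \<theta>\<close>, and the two paths part at their common starting point.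
\<close>

section \<open>Dyadic numbers\<close>

definition dyadic :: "real set" where
  "dyadic = {r. \<exists>(i::int) (n::nat). r = of_int i / 2 ^ n}"

lemma dyadicI: "r = of_int i / 2 ^ n \<Longrightarrow> r \<in> dyadic"
  unfolding dyadic_def by blast

lemma dyadic_of_int [simp]: "of_int i \<in> dyadic"
  by (rule dyadicI [of _ i 0]) simp

lemma dyadic_of_nat [simp]: "of_nat i \<in> dyadic"
  using dyadic_of_int [of "int i"] by simp

lemma dyadic_numeral [simp]: "numeral i \<in> dyadic" "0 \<in> dyadic" "1 \<in> dyadic"
  using dyadic_of_int [of "numeral i"] dyadic_of_int [of 0] dyadic_of_int [of 1] by simp_all

lemma dyadic_add [intro]:
  assumes "r \<in> dyadic" "s \<in> dyadic" shows "r + s \<in> dyadic"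
proof -
  obtain i m j n where "r = of_int i / 2 ^ m" "s = of_int j / 2 ^ n"
    using assms unfolding dyadic_def by blast
  then have "r + s = of_int (i * 2 ^ n + j * 2 ^ m) / 2 ^ (m + n)"
    by (simp add: power_add add_divide_distrib)
  then show ?thesis by (rule dyadicI)
qed

lemma dyadic_mult [intro]:
  assumes "r \<in> dyadic" "s \<in> dyadic" shows "r * s \<in> dyadic"
proof -
  obtain i m j n where "r = of_int i / 2 ^ m" "s = of_int j / 2 ^ n"
    using assms unfolding dyadic_def by blast
  then have "r * s = of_int (i * j) / 2 ^ (m + n)"
    by (simp add: power_add)
  then show ?thesis by (rule dyadicI)
qed

lemma dyadic_minus [intro]: "r \<in> dyadic \<Longrightarrow> - r \<in> dyadic"
  using dyadic_mult [OF dyadic_of_int [of "-1"], of r] by simp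

lemma dyadic_diff [intro]: "r \<in> dyadic \<Longrightarrow> s \<in> dyadic \<Longrightarrow> r - s \<in> dyadic"
  using dyadic_add [of r "- s"] by (simp add: dyadic_minus)

lemma dyadic_half_power [simp]: "(1/2) ^ n \<in> dyadic"
  by (rule dyadicI [of _ 1 n]) (simp add: power_one_over)

lemma dyadic_half_power_mult_iff [simp]: "(1/2) ^ n * r \<in> dyadic \<longleftrightarrow> r \<in> dyadic"
proof
  assume "(1/2) ^ n * r \<in> dyadic"
  from dyadic_mult [OF dyadic_of_int [of "2 ^ n"] this] show "r \<in> dyadic"
    by (simp add: power_one_over)
qed (simp add: dyadic_mult)

section \<open>Polygons made of grid cells\<close>

text \<open>
  A cell is a closed square of side \<open>\<delta>\<close> with corners in the lattice \<open>\<delta> \<int>\<^sup>2\<close>, given by the indices of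
  its lower left corner.  Unions of cells need no embeddedness of the boundary: the local structure
  near a point that is not a lattice point can be read off from at most two cells.
\<close>

definition cells :: "real \<Rightarrow> (int \<times> int) set \<Rightarrow> complex set" where
  "cells \<delta> Q = (\<Union>(i, j)\<in>Q. cbox (Complex (\<delta> * of_int i) (\<delta> * of_int j))
    (Complex (\<delta> * (of_int i + 1)) (\<delta> * (of_int j + 1))))"

lemma in_cells_iff:
  "w \<in> cells \<delta> Q \<longleftrightarrow> (\<exists>(i, j)\<in>Q. \<delta> * of_int i \<le> Re w \<and> Re w \<le> \<delta> * (of_int i + 1) \<and>
     \<delta> * of_int j \<le> Im w \<and> Im w \<le> \<delta> * (of_int j + 1))"
  unfolding cells_def UN_iff by (intro bex_cong) (auto simp: in_cbox_complex_iff)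

lemma cbox_eq_cells:
  fixes \<delta> :: real and p p' q q' :: int
  assumes \<delta>: "\<delta> > 0" and "p < p'" "q < q'"
  shows "cbox (Complex (\<delta> * p) (\<delta> * q)) (Complex (\<delta> * p') (\<delta> * q')) =
    cells \<delta> ({p..<p'} \<times> {q..<q'})"
proof -
  have interval: "\<exists>i\<in>{p..<p'}. \<delta> * i \<le> r \<and> r \<le> \<delta> * (i + 1)"
    if r: "\<delta> * p \<le> r" "r \<le> \<delta> * p'" and "p < p'" for r :: real and p p' :: int
  proof (cases "r = \<delta> * p'")
    case True
    then show ?thesis using \<open>p < p'\<close> \<delta>
      by (intro bexI [of _ "p' - 1"]) (auto simp: field_simps)
  next
    case False
    have "r / \<delta> < p'" "p \<le> r / \<delta>"
      using False r \<delta> by (auto simp: field_simps)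
    then have "\<lfloor>r / \<delta>\<rfloor> \<in> {p..<p'}"
      by (auto simp: le_floor_iff floor_less_iff)
    moreover have "of_int \<lfloor>r / \<delta>\<rfloor> \<le> r / \<delta>" "r / \<delta> \<le> of_int \<lfloor>r / \<delta>\<rfloor> + 1"
      by linarith+
    then have "\<delta> * of_int \<lfloor>r / \<delta>\<rfloor> \<le> r" "r \<le> \<delta> * (of_int \<lfloor>r / \<delta>\<rfloor> + 1)"
      using \<delta> by (simp_all only: pos_le_divide_eq pos_divide_le_eq mult.commute)
    ultimately show ?thesis by auto
  qed
  have bounds: "\<delta> * p \<le> r \<and> r \<le> \<delta> * p'"
    if "i \<in> {p..<p'}" "\<delta> * i \<le> r" "r \<le> \<delta> * (i + 1)" for r :: real and p p' i :: int
  proof -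
    have "real_of_int p \<le> i" "real_of_int i + 1 \<le> p'"
      using that(1) by auto
    then have "\<delta> * p \<le> \<delta> * i" "\<delta> * (i + 1) \<le> \<delta> * p'"
      using \<delta> by auto
    then show ?thesis using that by linarith
  qed
  show ?thesis
  proof (intro set_eqI iffI)
    fix w assume "w \<in> cbox (Complex (\<delta> * p) (\<delta> * q)) (Complex (\<delta> * p') (\<delta> * q'))"
    then have "\<delta> * p \<le> Re w" "Re w \<le> \<delta> * p'" "\<delta> * q \<le> Im w" "Im w \<le> \<delta> * q'"
      by (auto simp: in_cbox_complex_iff)
    with interval [of p "Re w" p'] interval [of q "Im w" q'] assms
    show "w \<in> cells \<delta> ({p..<p'} \<times> {q..<q'})"
      unfolding in_cells_iff by fastforce
  next
    fix w assume "w \<in> cells \<delta> ({p..<p'} \<times> {q..<q'})"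
    then obtain i j where "i \<in> {p..<p'}" "j \<in> {q..<q'}"
      "\<delta> * i \<le> Re w" "Re w \<le> \<delta> * (i + 1)" "\<delta> * j \<le> Im w" "Im w \<le> \<delta> * (j + 1)"
      unfolding in_cells_iff by fastforce
    then show "w \<in> cbox (Complex (\<delta> * p) (\<delta> * q)) (Complex (\<delta> * p') (\<delta> * q'))"
      using bounds [of i p p' "Re w"] bounds [of j q q' "Im w"]
      by (auto simp: in_cbox_complex_iff)
  qed
qed

text \<open>
  The law of reflection needs two things at a boundary point: the tangent, and on which side the
  region lies.  Both follow when the region is a half plane near the point; \<open>\<nu>\<close> is the inner normal.
\<close>

lemma tangent_of_half_plane:
  assumes "closed R" "norm \<nu> = 1" "e > 0"
    and R: "R \<inter> ball z e = {w. (w - z) \<bullet> \<nu> \<ge> 0} \<inter> ball z e"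
  shows "has_tangent (frontier R) z (\<i> * \<nu>)"
    and "w \<in> ball z e \<Longrightarrow> w \<in> interior R \<longleftrightarrow> (w - z) \<bullet> \<nu> > 0"
proof -
  have "{w. (w - z) \<bullet> \<nu> \<ge> 0} = {w. \<nu> \<bullet> w \<ge> \<nu> \<bullet> z}"
    by (simp add: inner_diff_left inner_commute [of \<nu>])
  moreover have "\<nu> \<noteq> 0" using \<open>norm \<nu> = 1\<close> by auto
  ultimately have "interior {w. (w - z) \<bullet> \<nu> \<ge> 0} = {w. \<nu> \<bullet> w > \<nu> \<bullet> z}"
    by (simp add: interior_halfspace_ge)
  also have "\<dots> = {w. (w - z) \<bullet> \<nu> > 0}"
    by (simp add: inner_diff_left inner_commute [of \<nu>])
  finally have "interior (R \<inter> ball z e) = {w. (w - z) \<bullet> \<nu> > 0} \<inter> ball z e"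
    unfolding R by (simp add: interior_Int)
  then have int: "interior R \<inter> ball z e = {w. (w - z) \<bullet> \<nu> > 0} \<inter> ball z e"
    by (simp add: interior_Int)
  then show "w \<in> ball z e \<Longrightarrow> w \<in> interior R \<longleftrightarrow> (w - z) \<bullet> \<nu> > 0"
    by blast
  have \<nu>: "Re \<nu> * Re \<nu> + Im \<nu> * Im \<nu> = 1"
    using \<open>norm \<nu> = 1\<close> by (simp add: cmod_def power2_eq_square)
  have line: "{w. (w - z) \<bullet> \<nu> = 0} = {z + s *\<^sub>R (\<i> * \<nu>) | s. True}"
  proof (intro set_eqI iffI)
    fix w assume "w \<in> {w. (w - z) \<bullet> \<nu> = 0}"
    then have *: "Re (w - z) * Re \<nu> + Im (w - z) * Im \<nu> = 0"
      by (simp add: inner_complex_def)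
    define p q a b where "p = Re (w - z)" and "q = Im (w - z)" and "a = Re \<nu>" and "b = Im \<nu>"
    note defs = this
    have pq: "p * a + q * b = 0" "a * a + b * b = 1"
      using * \<nu> by (simp_all add: defs)
    have "p = (q * a - p * b) * (- b) + (p * a + q * b) * a - p * (a * a + b * b - 1)"
      "q = (q * a - p * b) * a + (p * a + q * b) * b - q * (a * a + b * b - 1)"
      by (simp_all add: algebra_simps)
    then have "p = (q * a - p * b) * (- b)" "q = (q * a - p * b) * a"
      unfolding pq by simp_all
    then have "w = z + (q * a - p * b) *\<^sub>R (\<i> * \<nu>)"
      by (simp add: complex_eq_iff defs)
    then show "w \<in> {z + s *\<^sub>R (\<i> * \<nu>) | s. True}" by blast
  next
    fix w assume "w \<in> {z + s *\<^sub>R (\<i> * \<nu>) | s. True}"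
    then show "w \<in> {w. (w - z) \<bullet> \<nu> = 0}"
      by (auto simp: inner_complex_def algebra_simps)
  qed
  have "frontier R \<inter> ball z e = R \<inter> ball z e - interior R \<inter> ball z e"
    using \<open>closed R\<close> by (auto simp: frontier_def)
  also have "\<dots> = {w. (w - z) \<bullet> \<nu> = 0} \<inter> ball z e"
    unfolding R int by auto
  finally show "has_tangent (frontier R) z (\<i> * \<nu>)"
    unfolding has_tangent_def line using assms by (auto simp: norm_mult)
qed

lemma not_frontier_if_locally_constant:
  assumes "e > 0" "\<And>w. w \<in> ball z e \<Longrightarrow> w \<in> R \<longleftrightarrow> z \<in> R"
  shows "z \<notin> frontier R"
proof (cases "z \<in> R")
  case True
  then have "ball z e \<subseteq> R" using assms by blast
  then have "z \<in> interior R" using \<open>e > 0\<close> by (meson centre_in_ball interiorI open_ball)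
  then show ?thesis by (simp add: frontier_def)
next
  case False
  then have "ball z e \<subseteq> - R" using assms by blast
  then have "z \<in> interior (- R)" using \<open>e > 0\<close> by (meson centre_in_ball interiorI open_ball)
  then show ?thesis by (simp add: frontier_def closure_interior)
qed

lemma grid_cell_unique:
  fixes \<delta> r :: real and i j :: int
  assumes "\<delta> > 0" "\<delta> * of_int i < r" "r < \<delta> * (of_int i + 1)"
  shows "\<delta> * of_int j \<le> r \<and> r \<le> \<delta> * (of_int j + 1) \<longleftrightarrow> j = i"
proof
  assume "\<delta> * of_int j \<le> r \<and> r \<le> \<delta> * (of_int j + 1)"
  then have "\<delta> * of_int j < \<delta> * (of_int i + 1)" "\<delta> * of_int i < \<delta> * (of_int j + 1)" using assms by linarith+
  then have "real_of_int j < real_of_int i + 1" "real_of_int i < real_of_int j + 1"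
    using \<open>\<delta> > 0\<close> by simp_all
  then show "j = i" by linarith
qed (use assms in auto)

lemma off_grid_margin:
  fixes \<delta> r :: real
  assumes "\<delta> > 0" "\<And>j::int. r \<noteq> \<delta> * of_int j"
  shows "\<exists>e>0. \<exists>j::int. \<forall>r'. \<bar>r' - r\<bar> < e \<longrightarrow> \<delta> * of_int j < r' \<and> r' < \<delta> * (of_int j + 1)"
proof -
  define j where "j = \<lfloor>r / \<delta>\<rfloor>"
  have "of_int j \<le> r / \<delta>" "r / \<delta> < of_int j + 1"
    unfolding j_def by linarith+
  then have "\<delta> * of_int j \<le> r" "r < \<delta> * (of_int j + 1)"
    using \<open>\<delta> > 0\<close> by (auto simp: field_simps)
  with assms(2) [of j] have "\<delta> * of_int j < r" "r < \<delta> * (of_int j + 1)" by auto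
  then show ?thesis
    by (intro exI [of _ "min (r - \<delta> * j) (\<delta> * (of_int j + 1) - r)"] exI [of _ j] conjI) auto
qed

text \<open>
  Near a boundary point \<open>z\<close> whose coordinate \<open>g\<close> is off the grid, only the cells of one row \<open>j\<close> matter.
  If \<open>f z\<close> were off the grid too, membership would be constant near \<open>z\<close>.  So \<open>f z\<close> is on the grid, and
  exactly one of the two cells of the row that touch \<open>z\<close> belongs to the polygon.  The pair \<open>f\<close>, \<open>g\<close>
  stands for the two coordinates in either order, so that one proof serves vertical and horizontal
  sides.
\<close>

lemma grid_polygon_locally_half_plane:
  fixes f g :: "complex \<Rightarrow> real" and \<delta> :: real
  assumes \<delta>: "\<delta> > 0"
    and R: "\<And>w. w \<in> R \<longleftrightarrow> (\<exists>(i, j)\<in>Q. \<delta> * of_int i \<le> f w \<and> f w \<le> \<delta> * (of_int i + 1) \<and>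
          \<delta> * of_int j \<le> g w \<and> g w \<le> \<delta> * (of_int j + 1))"
    and lip: "\<And>w. \<bar>f w - f z\<bar> \<le> dist z w" "\<And>w. \<bar>g w - g z\<bar> \<le> dist z w"
    and off: "\<And>j::int. g z \<noteq> \<delta> * j"
    and z: "z \<in> frontier R"
  obtains i :: int and \<kappa> e where "f z = \<delta> * i" "\<kappa> \<in> {-1, 1}" "e > 0"
    "R \<inter> ball z e = {w. \<kappa> * (f w - f z) \<ge> 0} \<inter> ball z e"
proof -
  obtain j e1 where e1: "e1 > 0"
    "\<And>r. \<bar>r - g z\<bar> < e1 \<Longrightarrow> \<delta> * of_int j < r \<and> r < \<delta> * (of_int j + 1)"
    using off_grid_margin [OF \<delta> off] by meson
  have row: "w \<in> R \<longleftrightarrow> (\<exists>i. (i, j) \<in> Q \<and> \<delta> * of_int i \<le> f w \<and> f w \<le> \<delta> * (of_int i + 1))"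
    if "w \<in> ball z e1" for w
  proof -
    have "\<bar>g w - g z\<bar> < e1" using lip(2) [of w] that by auto
    then have "\<delta> * of_int j < g w" "g w < \<delta> * (of_int j + 1)"
      using e1(2) by auto
    note col = grid_cell_unique [OF \<delta> this]
    have "w \<in> R \<longleftrightarrow> (\<exists>i j'. (i, j') \<in> Q \<and> \<delta> * of_int i \<le> f w \<and> f w \<le> \<delta> * (of_int i + 1) \<and>
        \<delta> * of_int j' \<le> g w \<and> g w \<le> \<delta> * (of_int j' + 1))"
      unfolding R by blast
    then show ?thesis unfolding col by blast
  qed
  have on: "\<exists>i::int. f z = \<delta> * i"
  proof (rule ccontr)
    assume "\<not> ?thesis"
    then have "f z \<noteq> \<delta> * of_int i" for i by blast
    from off_grid_margin [OF \<delta> this] obtain i e2 where e2: "e2 > 0"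
      "\<And>r. \<bar>r - f z\<bar> < e2 \<Longrightarrow> \<delta> * of_int i < r \<and> r < \<delta> * (of_int i + 1)"
      by meson
    have "w \<in> R \<longleftrightarrow> (i, j) \<in> Q" if "w \<in> ball z (min e1 e2)" for w
    proof -
      have "\<bar>f w - f z\<bar> < e2" using lip(1) [of w] that by auto
      then have "\<delta> * of_int i < f w" "f w < \<delta> * (of_int i + 1)"
        using e2(2) by auto
      note col = grid_cell_unique [OF \<delta> this]
      have in_row: "w \<in> ball z e1" using that by simp
      show ?thesis unfolding row [OF in_row] col by blast
    qed
    then have "z \<notin> frontier R"
      using e1(1) e2(1) by (intro not_frontier_if_locally_constant [of "min e1 e2"]) auto
    with z show False by simp
  qed
  then obtain i :: int where i: "f z = \<delta> * i" by blast
  define e where "e = min e1 \<delta>"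
  have e: "e > 0" using e1 \<delta> by (simp add: e_def)
  have sides: "w \<in> R \<longleftrightarrow> ((i, j) \<in> Q \<and> f w \<ge> f z) \<or> ((i - 1, j) \<in> Q \<and> f w \<le> f z)"
    if "w \<in> ball z e" for w
  proof -
    have w: "\<bar>f w - f z\<bar> < \<delta>" using lip(1) [of w] that by (auto simp: e_def)
    have near: "\<delta> * of_int i' \<le> f w \<and> f w \<le> \<delta> * (of_int i' + 1) \<longleftrightarrow>
        (i' = i \<and> f w \<ge> f z) \<or> (i' = i - 1 \<and> f w \<le> f z)" for i' :: int
    proof -
      consider "f w < f z" | "f w = f z" | "f w > f z" by linarith
      then show ?thesis
      proof cases
        case 1
        then have "\<delta> * of_int (i - 1) < f w" "f w < \<delta> * (of_int (i - 1) + 1)"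
          using w i by (auto simp: algebra_simps)
        from grid_cell_unique [OF \<delta> this, of i'] 1 show ?thesis by auto
      next
        case 2
        have "\<delta> * of_int i' \<le> \<delta> * of_int i \<and> \<delta> * of_int i \<le> \<delta> * (of_int i' + 1) \<longleftrightarrow>
          real_of_int i' \<le> of_int i \<and> real_of_int i \<le> of_int i' + 1"
          using \<delta> by simp
        also have "\<dots> \<longleftrightarrow> i' = i \<or> i' = i - 1" by linarith
        finally show ?thesis using 2 i by auto
      next
        case 3
        then have "\<delta> * of_int i < f w" "f w < \<delta> * (of_int i + 1)"
          using w i by (auto simp: algebra_simps)
        from grid_cell_unique [OF \<delta> this, of i'] 3 show ?thesis by auto
      qed
    qed
    have in_row: "w \<in> ball z e1" using that by (simp add: e_def)
    show ?thesis unfolding row [OF in_row] near by blast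
  qed
  \<comment> \<open>Otherwise both or none of the two neighbouring cells are present, and \<open>z\<close> is no boundary point.\<close>
  have "((i, j) \<in> Q) \<noteq> ((i - 1, j) \<in> Q)"
  proof
    assume same: "((i, j) \<in> Q) = ((i - 1, j) \<in> Q)"
    have "w \<in> R \<longleftrightarrow> (i, j) \<in> Q" if "w \<in> ball z e" for w
      using sides [OF that] same by (cases "f w \<ge> f z") auto
    then have "z \<notin> frontier R"
      using e by (intro not_frontier_if_locally_constant [of e]) auto
    with z show False by simp
  qed
  then consider "\<And>w. w \<in> ball z e \<Longrightarrow> w \<in> R \<longleftrightarrow> f w \<ge> f z"
    | "\<And>w. w \<in> ball z e \<Longrightarrow> w \<in> R \<longleftrightarrow> f w \<le> f z"
    using sides by blast
  then show ?thesis
  proof cases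
    case 1
    then have "R \<inter> ball z e = {w. 1 * (f w - f z) \<ge> 0} \<inter> ball z e"
      by (auto simp del: mem_ball)
    from that [OF i _ e this] show ?thesis by simp
  next
    case 2
    then have "R \<inter> ball z e = {w. - 1 * (f w - f z) \<ge> 0} \<inter> ball z e"
      by (auto simp del: mem_ball)
    from that [OF i _ e this] show ?thesis by simp
  qed
qed

lemma has_tangent_minus: "has_tangent S z (- d) \<longleftrightarrow> has_tangent S z d"
proof -
  have "\<exists>s'. z + s *\<^sub>R d = z + s' *\<^sub>R (- d)" for s d
    by (rule exI [of _ "- s"]) simp
  from this [of _ d] this [of _ "- d"]
  have "{z + s *\<^sub>R (- d) | s. True} = {z + s *\<^sub>R d | s. True}"
    by auto
  then show ?thesis by (simp add: has_tangent_def)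
qed

lemma cells_vertical_side:
  assumes \<delta>: "\<delta> > 0" and R: "closed R" "R = cells \<delta> Q"
    and z: "z \<in> frontier R" "\<And>j::int. Im z \<noteq> \<delta> * j"
  shows "\<exists>i::int. Re z = \<delta> * i" "has_tangent (frontier R) z \<i>"
    "\<exists>\<kappa>\<in>{-1, 1}. \<exists>e>0. \<forall>w\<in>ball z e. w \<in> interior R \<longleftrightarrow> \<kappa> * (Re w - Re z) > 0"
proof -
  have lip: "\<bar>Re w - Re z\<bar> \<le> dist z w" "\<bar>Im w - Im z\<bar> \<le> dist z w" for w
    using abs_Re_le_cmod [of "w - z"] abs_Im_le_cmod [of "w - z"]
    by (auto simp: dist_norm norm_minus_commute)
  obtain i :: int and \<kappa> e where i: "Re z = \<delta> * i" and \<kappa>: "\<kappa> \<in> {-1, 1}" and e: "e > 0"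
    and half: "R \<inter> ball z e = {w. \<kappa> * (Re w - Re z) \<ge> 0} \<inter> ball z e"
  proof (rule grid_polygon_locally_half_plane [of \<delta> R Q Re Im z])
    show "w \<in> R \<longleftrightarrow> (\<exists>(i, j)\<in>Q. \<delta> * of_int i \<le> Re w \<and> Re w \<le> \<delta> * (of_int i + 1) \<and>
          \<delta> * of_int j \<le> Im w \<and> Im w \<le> \<delta> * (of_int j + 1))" for w
      unfolding R(2) in_cells_iff ..
  qed (use \<delta> lip z in auto)
  have inner: "(w - z) \<bullet> of_real \<kappa> = \<kappa> * (Re w - Re z)" for w
    by (simp add: inner_complex_def)
  have "norm (complex_of_real \<kappa>) = 1" using \<kappa> by auto
  note tang = tangent_of_half_plane [OF R(1) this e, where z = z, unfolded inner, OF half]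
  show "\<exists>i::int. Re z = \<delta> * i" using i by blast
  show "\<exists>\<kappa>\<in>{-1, 1}. \<exists>e>0. \<forall>w\<in>ball z e. w \<in> interior R \<longleftrightarrow> \<kappa> * (Re w - Re z) > 0"
    using \<kappa> e tang(2) by blast
  show "has_tangent (frontier R) z \<i>"
  proof (cases "\<kappa> = 1")
    case False
    with \<kappa> tang(1) have "has_tangent (frontier R) z (- \<i>)" by simp
    then show ?thesis unfolding has_tangent_minus .
  qed (use tang(1) in simp)
qed

lemma cells_horizontal_side:
  assumes \<delta>: "\<delta> > 0" and R: "closed R" "R = cells \<delta> Q"
    and z: "z \<in> frontier R" "\<And>i::int. Re z \<noteq> \<delta> * i"
  shows "\<exists>j::int. Im z = \<delta> * j" "has_tangent (frontier R) z 1"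
    "\<exists>\<kappa>\<in>{-1, 1}. \<exists>e>0. \<forall>w\<in>ball z e. w \<in> interior R \<longleftrightarrow> \<kappa> * (Im w - Im z) > 0"
proof -
  have lip: "\<bar>Re w - Re z\<bar> \<le> dist z w" "\<bar>Im w - Im z\<bar> \<le> dist z w" for w
    using abs_Re_le_cmod [of "w - z"] abs_Im_le_cmod [of "w - z"]
    by (auto simp: dist_norm norm_minus_commute)
  obtain j :: int and \<kappa> e where j: "Im z = \<delta> * j" and \<kappa>: "\<kappa> \<in> {-1, 1}" and e: "e > 0"
    and half: "R \<inter> ball z e = {w. \<kappa> * (Im w - Im z) \<ge> 0} \<inter> ball z e"
  proof (rule grid_polygon_locally_half_plane [of \<delta> R "prod.swap ` Q" Im Re z])
    show "w \<in> R \<longleftrightarrow> (\<exists>(i, j)\<in>prod.swap ` Q. \<delta> * of_int i \<le> Im w \<and> Im w \<le> \<delta> * (of_int i + 1) \<and>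
          \<delta> * of_int j \<le> Re w \<and> Re w \<le> \<delta> * (of_int j + 1))" for w
      unfolding R(2) in_cells_iff by (auto simp: case_prod_beta conj_ac)
  qed (use \<delta> lip z in auto)
  have inner: "(w - z) \<bullet> (of_real \<kappa> * \<i>) = \<kappa> * (Im w - Im z)" for w
    by (simp add: inner_complex_def)
  have "norm (complex_of_real \<kappa> * \<i>) = 1" using \<kappa> by (auto simp: norm_mult)
  note tang = tangent_of_half_plane [OF R(1) this e, where z = z, unfolded inner, OF half]
  show "\<exists>j::int. Im z = \<delta> * j" using j by blast
  show "\<exists>\<kappa>\<in>{-1, 1}. \<exists>e>0. \<forall>w\<in>ball z e. w \<in> interior R \<longleftrightarrow> \<kappa> * (Im w - Im z) > 0"
    using \<kappa> e tang(2) by blast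
  show "has_tangent (frontier R) z 1"
  proof (cases "\<kappa> = 1")
    case True
    with tang(1) have "has_tangent (frontier R) z (- 1)" by simp
    then show ?thesis unfolding has_tangent_minus .
  qed (use tang(1) \<kappa> in auto)
qed

section \<open>The prefractals as grid polygons\<close>

lemma in_tshape_iff:
  assumes "s > 0"
  shows "w \<in> tshape a s \<longleftrightarrow>
    (Re a \<le> Re w \<and> Re w \<le> Re a + 2 * s \<and> Im a \<le> Im w \<and> Im w \<le> Im a + 2 * s) \<or>
    (Re a - s \<le> Re w \<and> Re w \<le> Re a + 3 * s \<and> Im a + 2 * s \<le> Im w \<and> Im w \<le> Im a + 3 * s)"
proof -
  have "w \<in> tshape a s \<longleftrightarrow> (1 / s) *\<^sub>R (w - a) \<in> tshape0"
  proof
    assume "w \<in> tshape a s"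
    then obtain z where "z \<in> tshape0" "w = a + s *\<^sub>R z" by (auto simp: tshape_def)
    then show "(1 / s) *\<^sub>R (w - a) \<in> tshape0" using assms by simp
  next
    assume "(1 / s) *\<^sub>R (w - a) \<in> tshape0"
    moreover have "w = a + s *\<^sub>R ((1 / s) *\<^sub>R (w - a))" using assms by simp
    ultimately show "w \<in> tshape a s" unfolding tshape_def by blast
  qed
  also have "\<dots> \<longleftrightarrow> (0 \<le> (Re w - Re a) / s \<and> (Re w - Re a) / s \<le> 2 \<and>
        0 \<le> (Im w - Im a) / s \<and> (Im w - Im a) / s \<le> 2) \<or>
      (- 1 \<le> (Re w - Re a) / s \<and> (Re w - Re a) / s \<le> 3 \<and>
        2 \<le> (Im w - Im a) / s \<and> (Im w - Im a) / s \<le> 3)"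
    by (simp add: tshape0_def in_cbox_complex_iff conj_ac)
  also have "\<dots> \<longleftrightarrow>
    (Re a \<le> Re w \<and> Re w \<le> Re a + 2 * s \<and> Im a \<le> Im w \<and> Im w \<le> Im a + 2 * s) \<or>
    (Re a - s \<le> Re w \<and> Re w \<le> Re a + 3 * s \<and> Im a + 2 * s \<le> Im w \<and> Im w \<le> Im a + 3 * s)"
    using assms by (simp add: pos_le_divide_eq pos_divide_le_eq algebra_simps)
  finally show ?thesis .
qed

lemma tshape_eq_boxes:
  assumes "s > 0"
  shows "tshape a s = cbox a (Complex (Re a + 2 * s) (Im a + 2 * s)) \<union>
    cbox (Complex (Re a - s) (Im a + 2 * s)) (Complex (Re a + 3 * s) (Im a + 3 * s))"
  by (rule set_eqI) (simp add: in_tshape_iff [OF assms] in_cbox_complex_iff conj_ac)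

lemma base_points_on_grid:
  "a \<in> base_points k \<Longrightarrow> \<exists>p q. a = Complex ((1/2) ^ k * of_int p) ((1/2) ^ k * of_int q)"
proof (induction k arbitrary: a)
  case 0
  then show ?case by (auto intro!: exI [of _ 0] simp: complex_eq_iff)
next
  case (Suc k)
  from Suc.prems obtain b x where b: "b \<in> base_points k" and a: "a = b + (1/2) ^ k *\<^sub>R Complex x 3"
    and x: "x = -1 \<or> x = 2" by fastforce
  obtain p q :: int where "b = Complex ((1/2) ^ k * p) ((1/2) ^ k * q)" using Suc.IH [OF b] by blast
  then have "a = Complex ((1/2) ^ Suc k * of_int (2 * p + 2 * \<lfloor>x\<rfloor>)) ((1/2) ^ Suc k * of_int (2 * q + 6))"
    using x unfolding a by (auto simp: complex_eq_iff algebra_simps)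
  then show ?case by blast
qed

lemma finite_base_points: "finite (base_points k)"
  by (induction k) auto

text \<open>
  A T-shape of stage \<open>k \<le> n\<close> is a union of two boxes whose corners are multiples of \<open>(1/2) ^ k\<close>,
  hence of the finer unit \<open>(1/2) ^ n\<close>; \<open>N\<close> below is the ratio of the two units.
\<close>

lemma tshape_cells:
  assumes a: "a \<in> base_points k" and "k \<le> n"
  shows "\<exists>Q. tshape a ((1/2) ^ k) = cells ((1/2) ^ n) Q"
proof -
  obtain p q :: int where pq: "a = Complex ((1/2) ^ k * p) ((1/2) ^ k * q)"
    using base_points_on_grid [OF a] by blast
  define N :: int where "N = 2 ^ (n - k)"
  have N: "(1/2) ^ k = (1/2) ^ n * real_of_int N"
  proof -
    have "(1/2::real) ^ n = (1/2) ^ k * (1/2) ^ (n - k)"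
      using \<open>k \<le> n\<close> by (simp flip: power_add)
    then show ?thesis by (simp add: N_def power_one_over)
  qed
  have "N > 0" by (simp add: N_def)
  have "tshape a ((1/2) ^ k) =
     cbox (Complex ((1/2) ^ n * of_int (p * N)) ((1/2) ^ n * of_int (q * N)))
       (Complex ((1/2) ^ n * of_int ((p + 2) * N)) ((1/2) ^ n * of_int ((q + 2) * N))) \<union>
     cbox (Complex ((1/2) ^ n * of_int ((p - 1) * N)) ((1/2) ^ n * of_int ((q + 2) * N)))
       (Complex ((1/2) ^ n * of_int ((p + 3) * N)) ((1/2) ^ n * of_int ((q + 3) * N)))"
    unfolding pq using \<open>N > 0\<close>
    by (subst tshape_eq_boxes) (simp_all add: N zero_less_mult_iff algebra_simps)
  also have "\<dots> = cells ((1/2) ^ n) ({p * N..<(p + 2) * N} \<times> {q * N..<(q + 2) * N}) \<union>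
      cells ((1/2) ^ n) ({(p - 1) * N..<(p + 3) * N} \<times> {(q + 2) * N..<(q + 3) * N})"
    using \<open>N > 0\<close> by (subst (1 2) cbox_eq_cells) auto
  also have "\<dots> = cells ((1/2) ^ n) ({p * N..<(p + 2) * N} \<times> {q * N..<(q + 2) * N} \<union>
      {(p - 1) * N..<(p + 3) * N} \<times> {(q + 2) * N..<(q + 3) * N})"
    by (simp add: cells_def)
  finally show ?thesis by blast
qed

lemma closed_region_cells: "\<exists>Q. closed_region n = cells ((1/2) ^ n) Q"
proof -
  have "\<forall>k a. \<exists>Q. k \<le> n \<and> a \<in> base_points k \<longrightarrow> tshape a ((1/2) ^ k) = cells ((1/2) ^ n) Q"
    using tshape_cells by blast
  then obtain Q where "\<And>k a. k \<le> n \<and> a \<in> base_points k \<Longrightarrow> tshape a ((1/2) ^ k) = cells ((1/2) ^ n) (Q k a)"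
    by metis
  then have "closed_region n = (\<Union>k\<le>n. \<Union>a\<in>base_points k. cells ((1/2) ^ n) (Q k a))"
    by (simp add: closed_region_def)
  also have "\<dots> = cells ((1/2) ^ n) (\<Union>k\<le>n. \<Union>a\<in>base_points k. Q k a)"
    unfolding cells_def by blast
  finally show ?thesis by blast
qed

lemma compact_closed_region: "compact (closed_region n)"
  unfolding closed_region_def
  by (intro compact_UN finite_base_points) (auto simp: tshape_eq_boxes intro!: compact_Un)

lemma closed_closed_region: "closed (closed_region n)"
  by (simp add: compact_closed_region compact_imp_closed)

lemma prefractal_subset: "prefractal n \<subseteq> closed_region n"
  by (simp add: prefractal_def frontier_subset_closed closed_closed_region)

lemma prefractal_iff: "z \<in> prefractal n \<longleftrightarrow> z \<in> closed_region n \<and> z \<notin> prefractal_region n"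
  by (simp add: prefractal_def prefractal_region_def frontier_def closure_closed closed_closed_region)

definition grid :: "nat \<Rightarrow> real set" where
  "grid n = range (\<lambda>j::int. (1/2) ^ n * of_int j)"

lemma grid_dyadic: "grid n \<subseteq> dyadic"
  by (auto simp: grid_def)

lemma prefractal_vertical_side:
  assumes "z \<in> prefractal n" "Im z \<notin> grid n"
  shows "Re z \<in> grid n" "has_tangent (prefractal n) z \<i>"
    "\<exists>\<kappa>\<in>{-1, 1}. \<exists>e>0. \<forall>w\<in>ball z e. w \<in> prefractal_region n \<longleftrightarrow> \<kappa> * (Re w - Re z) > 0"
proof -
  obtain Q where Q: "closed_region n = cells ((1/2) ^ n) Q" using closed_region_cells by blast
  note * = cells_vertical_side [OF _ closed_closed_region Q, of z]
  show "Re z \<in> grid n" "has_tangent (prefractal n) z \<i>"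
    "\<exists>\<kappa>\<in>{-1, 1}. \<exists>e>0. \<forall>w\<in>ball z e. w \<in> prefractal_region n \<longleftrightarrow> \<kappa> * (Re w - Re z) > 0"
    using * assms unfolding prefractal_def prefractal_region_def grid_def
    by (auto simp del: mem_ball)
qed

lemma prefractal_horizontal_side:
  assumes "z \<in> prefractal n" "Re z \<notin> grid n"
  shows "Im z \<in> grid n" "has_tangent (prefractal n) z 1"
    "\<exists>\<kappa>\<in>{-1, 1}. \<exists>e>0. \<forall>w\<in>ball z e. w \<in> prefractal_region n \<longleftrightarrow> \<kappa> * (Im w - Im z) > 0"
proof -
  obtain Q where Q: "closed_region n = cells ((1/2) ^ n) Q" using closed_region_cells by blast
  note * = cells_horizontal_side [OF _ closed_closed_region Q, of z]
  show "Im z \<in> grid n" "has_tangent (prefractal n) z 1"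
    "\<exists>\<kappa>\<in>{-1, 1}. \<exists>e>0. \<forall>w\<in>ball z e. w \<in> prefractal_region n \<longleftrightarrow> \<kappa> * (Im w - Im z) > 0"
    using * assms unfolding prefractal_def prefractal_region_def grid_def
    by (auto simp del: mem_ball)
qed

section \<open>Periodic orbits in lattice directions\<close>

text \<open>
  The next basepoint exists because the region is bounded: it is reached at the infimum of the times at
  which the ray is outside the interior.  The infimum is taken over times \<open>\<ge> e/2\<close> to keep it away from
  the starting point, which may itself lie on the boundary.
\<close>

lemma first_exit:
  fixes z u :: "'a::real_normed_vector"
  assumes R: "closed R" "bounded R" and "u \<noteq> 0"
    and e: "e > 0" "\<And>t. 0 < t \<Longrightarrow> t < e \<Longrightarrow> z + t *\<^sub>R u \<in> interior R"
  obtains T where "T > 0" "z + T *\<^sub>R u \<in> frontier R"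
    "\<And>t. 0 < t \<Longrightarrow> t < T \<Longrightarrow> z + t *\<^sub>R u \<in> interior R"
proof -
  define B where "B = {e/2..} \<inter> (\<lambda>t. z + t *\<^sub>R u) -` (- interior R)"
  have "closed B" unfolding B_def
    by (intro closed_Int closed_vimage continuous_intros) (auto intro: closed_Compl)
  obtain M where M: "\<And>x. x \<in> R \<Longrightarrow> norm x \<le> M" using R(2) bounded_iff by metis
  define t0 where "t0 = max (e/2) ((\<bar>M\<bar> + norm z + 1) / norm u)"
  have "t0 * norm u \<ge> (\<bar>M\<bar> + norm z + 1) / norm u * norm u"
    unfolding t0_def by (intro mult_right_mono) auto
  then have "t0 * norm u \<ge> \<bar>M\<bar> + norm z + 1" using \<open>u \<noteq> 0\<close> by simp
  moreover have "norm (z + t0 *\<^sub>R u) \<ge> t0 * norm u - norm z"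
    using norm_diff_ineq [of "t0 *\<^sub>R u" z] e by (simp add: t0_def add.commute max_def split: if_splits)
  ultimately have "z + t0 *\<^sub>R u \<notin> R" using M [of "z + t0 *\<^sub>R u"] by linarith
  then have "t0 \<in> B" unfolding B_def using interior_subset [of R] by (auto simp: t0_def)
  define T where "T = Inf B"
  have bdd: "bdd_below B" unfolding B_def by (intro bdd_belowI [of _ "e/2"]) auto
  have "T \<in> B" unfolding T_def
    using \<open>t0 \<in> B\<close> bdd \<open>closed B\<close> by (intro closed_contains_Inf) auto
  then have "T \<ge> e/2" and T: "z + T *\<^sub>R u \<notin> interior R" by (auto simp: B_def)
  then have "T > 0" using e by linarith
  have inside: "z + t *\<^sub>R u \<in> interior R" if "0 < t" "t < T" for t
  proof (cases "t < e/2")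
    case True
    then show ?thesis using e that by auto
  next
    case False
    have "t \<notin> B" using cInf_lower [OF _ bdd, of t] that by (auto simp: T_def)
    with False show ?thesis by (auto simp: B_def)
  qed
  have "z + T *\<^sub>R u \<in> closure (interior R)"
    unfolding closure_approachable
  proof (intro allI impI)
    fix d :: real assume "d > 0"
    define h where "h = min (T/2) (d / (2 * norm u))"
    have "h > 0" "h < T" using \<open>T > 0\<close> \<open>d > 0\<close> \<open>u \<noteq> 0\<close> by (auto simp: h_def)
    have "h * norm u \<le> d / (2 * norm u) * norm u"
      by (intro mult_right_mono) (auto simp: h_def)
    also have "\<dots> < d" using \<open>u \<noteq> 0\<close> \<open>d > 0\<close> by simp
    finally have "dist (z + (T - h) *\<^sub>R u) (z + T *\<^sub>R u) < d"
      using \<open>h > 0\<close> by (simp add: dist_norm scaleR_diff_left)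
    then show "\<exists>y\<in>interior R. dist y (z + T *\<^sub>R u) < d"
      using inside [of "T - h"] \<open>h > 0\<close> \<open>h < T\<close> by fastforce
  qed
  then have "z + T *\<^sub>R u \<in> R"
    using R(1) closure_mono [OF interior_subset [of R]] by (auto simp: closure_closed)
  with T have "z + T *\<^sub>R u \<in> frontier R" using R(1) by (simp add: frontier_def closure_closed)
  with \<open>T > 0\<close> inside show ?thesis using that by blast
qed

lemma injective_on_finite_set_periodic:
  assumes "finite S" "f ` S \<subseteq> S" "inj_on f S" "s \<in> S"
  obtains m where "m \<ge> 1" "(f ^^ m) s = s"
proof -
  have inS: "(f ^^ i) x \<in> S" if "x \<in> S" for i x
    using that assms(2) by (induction i) auto
  have inj: "inj_on (f ^^ i) S" for i
  proof (induction i)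
    case (Suc i)
    show ?case
    proof (rule inj_onI)
      fix x y assume xy: "x \<in> S" "y \<in> S" "(f ^^ Suc i) x = (f ^^ Suc i) y"
      then have "(f ^^ i) x = (f ^^ i) y"
        using inj_onD [OF assms(3) _ inS inS] by simp
      then show "x = y" using inj_onD [OF Suc] xy(1,2) by blast
    qed
  qed simp
  have "finite (range (\<lambda>i. (f ^^ i) s))"
    using assms(1) by (rule rev_finite_subset) (use inS assms(4) in auto)
  then have "\<not> inj (\<lambda>i. (f ^^ i) s)" using finite_imageD infinite_UNIV_nat by blast
  then obtain i j where "i \<noteq> j" "(f ^^ i) s = (f ^^ j) s" by (auto simp: inj_def)
  then obtain i j where "i < j" and eq: "(f ^^ i) s = (f ^^ j) s"
    by (metis linorder_neqE_nat)
  have "(f ^^ j) s = (f ^^ i) ((f ^^ (j - i)) s)"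
    using \<open>i < j\<close> by (metis funpow_add le_add_diff_inverse less_imp_le o_apply)
  then have "s = (f ^^ (j - i)) s"
    using inj_onD [OF inj [of i], of s "(f ^^ (j - i)) s"] eq inS assms(4) by simp
  with \<open>i < j\<close> show ?thesis using that [of "j - i"] by simp
qed

lemma gridI: "(1/2) ^ n * of_int j \<in> grid n"
  by (auto simp: grid_def)

lemma zero_in_grid [simp]: "0 \<in> grid n"
  using gridI [of n 0] by simp

lemma grid_add: "x \<in> grid n \<Longrightarrow> y \<in> grid n \<Longrightarrow> x + y \<in> grid n"
  unfolding grid_def by (auto simp flip: distrib_left of_int_add)

lemma grid_int_mult:
  assumes "x \<in> grid n" shows "of_int k * x \<in> grid n"
proof -
  obtain j where "x = (1/2) ^ n * of_int j" using assms by (auto simp: grid_def)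
  then have "of_int k * x = (1/2) ^ n * of_int (k * j)" by simp
  then show ?thesis using gridI by metis
qed

lemma grid_minus: "x \<in> grid n \<Longrightarrow> - x \<in> grid n"
  using grid_int_mult [of x n "-1"] by simp

lemma finite_grid_interval: "finite (grid n \<inter> {a..b})"
proof -
  have "grid n \<inter> {a..b} \<subseteq> (\<lambda>j. (1/2) ^ n * of_int j) ` {\<lfloor>2 ^ n * a\<rfloor>..\<lceil>2 ^ n * b\<rceil>}"
  proof
    fix x assume "x \<in> grid n \<inter> {a..b}"
    then obtain j where x: "x = (1/2) ^ n * of_int j" and "a \<le> x" "x \<le> b" by (auto simp: grid_def)
    then have j: "of_int j = 2 ^ n * x" by (simp add: power_one_over)
    have "2 ^ n * a \<le> of_int j" "of_int j \<le> 2 ^ n * b"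
      unfolding j using \<open>a \<le> x\<close> \<open>x \<le> b\<close> by simp_all
    then have "j \<in> {\<lfloor>2 ^ n * a\<rfloor>..\<lceil>2 ^ n * b\<rceil>}"
      by (auto simp: floor_le_iff le_ceiling_iff)
    with x show "x \<in> (\<lambda>j. (1/2) ^ n * of_int j) ` {\<lfloor>2 ^ n * a\<rfloor>..\<lceil>2 ^ n * b\<rceil>}" by blast
  qed
  then show ?thesis by (rule finite_subset) simp
qed

text \<open>
  The values that the phase \<open>x - \<sigma> \<rho> c y\<close> can take along an orbit that starts with phase \<open>\<plusminus> \<alpha>\<close>: at
  a horizontal side it is shifted by a grid number, at a vertical one it also changes its sign.
\<close>

definition phases :: "nat \<Rightarrow> real \<Rightarrow> real set" where
  "phases n \<alpha> = {x. x - \<alpha> \<in> grid n \<or> x + \<alpha> \<in> grid n}"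

lemma phases_add_grid:
  assumes "x \<in> phases n \<alpha>" "g \<in> grid n" shows "x + g \<in> phases n \<alpha>"
proof -
  have "(x - \<alpha>) + g = (x + g) - \<alpha>" "(x + \<alpha>) + g = (x + g) + \<alpha>" by simp_all
  then show ?thesis using assms grid_add [of _ n g] unfolding phases_def mem_Collect_eq by metis
qed

lemma phases_minus:
  assumes "x \<in> phases n \<alpha>" shows "- x \<in> phases n \<alpha>"
proof -
  have "- (x - \<alpha>) = - x + \<alpha>" "- (x + \<alpha>) = - x - \<alpha>" by simp_all
  then show ?thesis using assms grid_minus unfolding phases_def mem_Collect_eq by metis
qed

lemma phases_not_grid:
  assumes "x \<in> phases n \<alpha>" "\<alpha> \<notin> grid n" shows "x \<notin> grid n"
proof
  assume "x \<in> grid n"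
  then have "(x - \<alpha>) + - x \<in> grid n \<or> (x + \<alpha>) + - x \<in> grid n"
    using assms(1) by (auto simp only: phases_def mem_Collect_eq intro: grid_add grid_minus)
  then have "- \<alpha> \<in> grid n \<or> \<alpha> \<in> grid n" by simp
  then show False using assms(2) grid_minus [of "- \<alpha>" n] by auto
qed

lemma finite_phases_interval: "finite (phases n \<alpha> \<inter> {a..b})"
proof (rule finite_subset)
  show "phases n \<alpha> \<inter> {a..b} \<subseteq> (\<lambda>x. x + \<alpha>) ` (grid n \<inter> {a - \<alpha>..b - \<alpha>}) \<union>
      (\<lambda>x. x - \<alpha>) ` (grid n \<inter> {a + \<alpha>..b + \<alpha>})"
  proof
    fix x assume "x \<in> phases n \<alpha> \<inter> {a..b}"
    then have "x - \<alpha> \<in> grid n \<inter> {a - \<alpha>..b - \<alpha>} \<or> x + \<alpha> \<in> grid n \<inter> {a + \<alpha>..b + \<alpha>}"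
      by (auto simp: phases_def)
    moreover have "x = (x - \<alpha>) + \<alpha>" "x = (x + \<alpha>) - \<alpha>" by simp_all
    ultimately show "x \<in> (\<lambda>x. x + \<alpha>) ` (grid n \<inter> {a - \<alpha>..b - \<alpha>}) \<union>
      (\<lambda>x. x - \<alpha>) ` (grid n \<inter> {a + \<alpha>..b + \<alpha>})" by blast
  qed
qed (intro finite_UnI finite_imageI finite_grid_interval)

definition inward :: "nat \<Rightarrow> complex \<Rightarrow> complex \<Rightarrow> bool" where
  "inward n z u \<longleftrightarrow> (\<exists>e>0. \<forall>t. 0 < t \<and> t < e \<longrightarrow> z + t *\<^sub>R u \<in> prefractal_region n)"

text \<open>
  On the orbits considered here a boundary point has exactly one coordinate on the grid, which
  tells horizontal sides from vertical ones.
\<close>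

definition bounce :: "nat \<Rightarrow> complex \<Rightarrow> complex \<Rightarrow> complex" where
  "bounce n z u = (if Im z \<in> grid n then cnj u else - cnj u)"

text \<open>
  Here \<open>f\<close> is the coordinate that is constant along the side through \<open>z\<close>, and \<open>\<kappa>\<close> tells on which side
  the region lies.  A vector at \<open>z\<close> points inward if and only if \<open>\<kappa> f\<close> is positive on it.
  Reflection reverses this component, and so does reversing time; therefore \<open>bounce n z u\<close> points
  inward whenever the reversed incoming velocity \<open>- u\<close> does.
\<close>

lemma inward_mirror:
  fixes f :: "complex \<Rightarrow> real"
  assumes f: "linear f" and ball: "e > 0"
      "\<And>w. w \<in> ball z e \<Longrightarrow> w \<in> prefractal_region n \<longleftrightarrow> \<kappa> * (f w - f z) > 0"
    and "f u = f u'" "inward n z u"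
  shows "inward n z u'"
proof -
  have iff: "z + t *\<^sub>R v \<in> prefractal_region n \<longleftrightarrow> t * (\<kappa> * f v) > 0"
    if "0 < t" "t < e / (norm v + 1)" for t v
  proof -
    have "norm v + 1 > 0" by (simp add: add_nonneg_pos)
    then have "t * (norm v + 1) < e" using that by (simp add: pos_less_divide_eq)
    moreover have "t * norm v \<le> t * (norm v + 1)" using \<open>0 < t\<close> by simp
    ultimately have "t * norm v < e" by linarith
    then have "z + t *\<^sub>R v \<in> ball z e" using \<open>0 < t\<close> by (simp add: dist_norm)
    from ball(2) [OF this] show ?thesis
      by (simp add: linear_add [OF f] linear_scale [OF f] mult_ac)
  qed
  obtain e1 where "e1 > 0" and e1: "\<And>t. 0 < t \<Longrightarrow> t < e1 \<Longrightarrow> z + t *\<^sub>R u \<in> prefractal_region n"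
    using \<open>inward n z u\<close> unfolding inward_def by blast
  define d where "d = e / (norm u + 1)"
  have "d > 0" using \<open>e > 0\<close> by (simp add: d_def add_nonneg_pos)
  define t where "t = min e1 d / 2"
  have "0 < t" "t < e1" "t < e / (norm u + 1)"
    using \<open>e1 > 0\<close> \<open>d > 0\<close> unfolding t_def d_def [symmetric] by auto
  with iff e1 have "t * (\<kappa> * f u) > 0" by blast
  then have "\<kappa> * f u' > 0" using \<open>0 < t\<close> \<open>f u = f u'\<close> by (simp add: zero_less_mult_iff)
  then have "\<forall>t. 0 < t \<and> t < e / (norm u' + 1) \<longrightarrow> z + t *\<^sub>R u' \<in> prefractal_region n"
    using iff by simp
  moreover have "e / (norm u' + 1) > 0" using \<open>e > 0\<close> by (simp add: add_nonneg_pos)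
  ultimately show ?thesis unfolding inward_def by blast
qed

lemma bounce_inward:
  assumes z: "z \<in> prefractal n" "Re z \<notin> grid n \<or> Im z \<notin> grid n"
    and "inward n z (- u)"
  shows "reflects n z u (bounce n z u)" "inward n z (bounce n z u)"
proof -
  have "reflects n z u (bounce n z u) \<and> inward n z (bounce n z u)"
  proof (cases "Im z \<in> grid n")
    case True
    then have "Re z \<notin> grid n" using z by blast
    note side = prefractal_horizontal_side [OF z(1) this]
    have "bounce n z u = (2 * (u \<bullet> 1)) *\<^sub>R 1 - u"
      using True by (simp add: bounce_def complex_eq_iff inner_complex_def)
    then have "reflects n z u (bounce n z u)" using reflects.side [OF side(2)] by simp
    moreover obtain \<kappa> e where "e > 0"
      "\<And>w. w \<in> ball z e \<Longrightarrow> w \<in> prefractal_region n \<longleftrightarrow> \<kappa> * (Im w - Im z) > 0"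
      using side(3) by blast
    from inward_mirror [OF bounded_linear.linear [OF bounded_linear_Im] this, where u = "- u"]
    have "inward n z (bounce n z u)" using True \<open>inward n z (- u)\<close> by (simp add: bounce_def)
    ultimately show ?thesis by blast
  next
    case False
    note side = prefractal_vertical_side [OF z(1) this]
    have "bounce n z u = (2 * (u \<bullet> \<i>)) *\<^sub>R \<i> - u"
      using False by (simp add: bounce_def complex_eq_iff inner_complex_def)
    then have "reflects n z u (bounce n z u)" using reflects.side [OF side(2)] by simp
    moreover obtain \<kappa> e where "e > 0"
      "\<And>w. w \<in> ball z e \<Longrightarrow> w \<in> prefractal_region n \<longleftrightarrow> \<kappa> * (Re w - Re z) > 0"
      using side(3) by blast
    from inward_mirror [OF bounded_linear.linear [OF bounded_linear_Re] this, where u = "- u"]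
    have "inward n z (bounce n z u)" using False \<open>inward n z (- u)\<close> by (simp add: bounce_def)
    ultimately show ?thesis by blast
  qed
  then show "reflects n z u (bounce n z u)" "inward n z (bounce n z u)" by blast+
qed

text \<open>
  Pairs of a boundary point and an inward velocity of direction \<open>(\<plusminus> c, \<plusminus> 1)\<close> whose phase is
  admissible.  The scale \<open>r\<close> makes the velocity a unit vector in the application.
\<close>

definition billiard_states :: "nat \<Rightarrow> nat \<Rightarrow> real \<Rightarrow> real \<Rightarrow> (complex \<times> complex) set" where
  "billiard_states n c r \<alpha> = {(z, u). z \<in> prefractal n \<and> inward n z u \<and>
     (\<exists>\<sigma>\<in>{-1, 1}. \<exists>\<rho>\<in>{-1, 1}. u = Complex (\<sigma> * real c * r) (\<rho> * r) \<and>
        Re z - \<sigma> * \<rho> * real c * Im z \<in> phases n \<alpha>)}"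

text \<open>
  The billiard map with the explicit reflection rule \<^const>\<open>bounce\<close>.  As \<open>bounce n z\<close> is an
  involution, this relation can be inverted at sight, which is all that periodicity needs.
\<close>

definition regular_step :: "nat \<Rightarrow> complex \<times> complex \<Rightarrow> complex \<times> complex \<Rightarrow> bool" where
  "regular_step n = (\<lambda>(x, u) (x', u').
     (\<exists>T>0. x' = x + T *\<^sub>R u \<and> (\<forall>t. 0 < t \<and> t < T \<longrightarrow> x + t *\<^sub>R u \<in> prefractal_region n)) \<and>
     x' \<in> prefractal n \<and> u' = bounce n x' u)"

lemma open_segment_ray:
  fixes x u :: "'a::real_vector"
  assumes "T > 0" "w \<in> open_segment x (x + T *\<^sub>R u)"
  shows "\<exists>t. 0 < t \<and> t < T \<and> w = x + t *\<^sub>R u"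
proof -
  obtain s where "0 < s" "s < 1" "w = (1 - s) *\<^sub>R x + s *\<^sub>R (x + T *\<^sub>R u)"
    using assms(2) by (auto simp: in_segment)
  then have "w = x + (s * T) *\<^sub>R u" "0 < s * T" "s * T < T"
    using \<open>T > 0\<close> by (auto simp: algebra_simps)
  then show ?thesis by blast
qed

lemma regular_step_inward:
  assumes "regular_step n (x, u) (x', u')"
  shows "inward n x' (- u)"
proof -
  obtain T where "T > 0" "x' = x + T *\<^sub>R u"
    and T: "\<And>t. 0 < t \<Longrightarrow> t < T \<Longrightarrow> x + t *\<^sub>R u \<in> prefractal_region n"
    using assms unfolding regular_step_def by auto
  then have "x' + t *\<^sub>R (- u) = x + (T - t) *\<^sub>R u" for t by (simp add: algebra_simps)
  then show ?thesis unfolding inward_def using \<open>T > 0\<close> T by (intro exI [of _ T]) auto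
qed

lemma regular_step_billiard:
  assumes step: "regular_step n (x, u) (x', u')" and off: "Re x' \<notin> grid n \<or> Im x' \<notin> grid n"
  shows "billiard_step n (x, u) (x', u')" "inward n x' u'"
proof -
  obtain T where T: "T > 0" "x' = x + T *\<^sub>R u"
    "\<And>t. 0 < t \<Longrightarrow> t < T \<Longrightarrow> x + t *\<^sub>R u \<in> prefractal_region n"
    and x': "x' \<in> prefractal n" and u': "u' = bounce n x' u"
    using step unfolding regular_step_def by auto
  note * = bounce_inward [OF x' off regular_step_inward [OF step]]
  show "inward n x' u'" using *(2) u' by simp
  have "open_segment x x' \<subseteq> prefractal_region n"
    using open_segment_ray [OF T(1), of _ x u] T(2,3) by blast
  with T(1,2) x' *(1) show "billiard_step n (x, u) (x', u')"
    unfolding billiard_step_def u' by auto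
qed

text \<open>
  Since \<open>c\<close> is an integer, a lattice point has a phase on the grid, and no admissible phase is.
\<close>

lemma billiard_states_off_grid:
  assumes "Re z - \<sigma> * \<rho> * real c * Im z \<in> phases n \<alpha>" "\<sigma> \<in> {-1, 1}" "\<rho> \<in> {-1, 1}" "\<alpha> \<notin> grid n"
  shows "Re z \<notin> grid n \<or> Im z \<notin> grid n"
proof (rule ccontr)
  assume "\<not> ?thesis"
  then have *: "Re z \<in> grid n" "Im z \<in> grid n" by auto
  have "\<sigma> * \<rho> \<in> {-1, 1}" using assms by auto
  then obtain k :: int where "\<sigma> * \<rho> * real c = of_int k"
    by (metis insertE of_int_minus of_int_of_nat_eq mult_minus1 mult_1 singletonD)
  then have "\<sigma> * \<rho> * real c * Im z \<in> grid n" using grid_int_mult [OF *(2)] by simp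
  then have "Re z + - (\<sigma> * \<rho> * real c * Im z) \<in> grid n" by (intro grid_add grid_minus *(1))
  with phases_not_grid [OF assms(1,4)] show False by simp
qed

lemma regular_step_states:
  assumes S: "(x, u) \<in> billiard_states n c r \<alpha>" and "\<alpha> \<notin> grid n" "c > 0" "r > 0"
  obtains s' where "regular_step n (x, u) s'" "s' \<in> billiard_states n c r \<alpha>" "billiard_step n (x, u) s'"
proof -
  obtain \<sigma> \<rho> where \<sigma>: "\<sigma> \<in> {-1, 1}" and \<rho>: "\<rho> \<in> {-1, 1}"
    and u: "u = Complex (\<sigma> * real c * r) (\<rho> * r)"
    and ph: "Re x - \<sigma> * \<rho> * real c * Im x \<in> phases n \<alpha>" and x: "x \<in> prefractal n" "inward n x u"
    using S unfolding billiard_states_def mem_Collect_eq prod.case by blast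
  have "u \<noteq> 0" using \<rho> \<open>r > 0\<close> by (auto simp: u complex_eq_iff)
  obtain e where "e > 0" "\<And>t. 0 < t \<Longrightarrow> t < e \<Longrightarrow> x + t *\<^sub>R u \<in> interior (closed_region n)"
    using x(2) unfolding inward_def prefractal_region_def by blast
  from first_exit [OF closed_closed_region compact_imp_bounded [OF compact_closed_region] \<open>u \<noteq> 0\<close> this]
  obtain T where T: "T > 0" "x + T *\<^sub>R u \<in> prefractal n"
    "\<And>t. 0 < t \<Longrightarrow> t < T \<Longrightarrow> x + t *\<^sub>R u \<in> prefractal_region n"
    unfolding prefractal_def prefractal_region_def by blast
  define z where "z = x + T *\<^sub>R u"
  have \<sigma>\<rho>: "\<sigma> * \<sigma> = 1" "\<rho> * \<rho> = 1" using \<sigma> \<rho> by auto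
  have "Re z - \<sigma> * \<rho> * real c * Im z =
      (Re x - \<sigma> * \<rho> * real c * Im x) + T * \<sigma> * real c * r * (1 - \<rho> * \<rho>)"
    by (simp add: z_def u algebra_simps)
  then have ph': "Re z - \<sigma> * \<rho> * real c * Im z \<in> phases n \<alpha>"
    using ph by (simp add: \<sigma>\<rho>)
  note off = billiard_states_off_grid [OF ph' \<sigma> \<rho> \<open>\<alpha> \<notin> grid n\<close>]
  have step: "regular_step n (x, u) (z, bounce n z u)"
    unfolding regular_step_def using T by (auto simp: z_def)
  have z: "z \<in> prefractal n" using T z_def by simp
  have "(z, bounce n z u) \<in> billiard_states n c r \<alpha>"
  proof (cases "Im z \<in> grid n")
    case True
    have "bounce n z u = Complex (\<sigma> * real c * r) ((- \<rho>) * r)"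
      using True by (simp add: bounce_def u complex_eq_iff)
    moreover have "of_int (2 * (if \<sigma> * \<rho> = 1 then int c else - int c)) * Im z \<in> grid n"
      by (rule grid_int_mult [OF True])
    then have "2 * (\<sigma> * \<rho> * real c * Im z) \<in> grid n"
      using \<sigma> \<rho> by (auto split: if_splits simp: algebra_simps)
    from phases_add_grid [OF ph' this]
    have "Re z - \<sigma> * (- \<rho>) * real c * Im z \<in> phases n \<alpha>" by (simp add: algebra_simps)
    moreover have "- \<rho> \<in> {-1, 1}" using \<rho> by auto
    ultimately show ?thesis
      using z \<sigma> regular_step_billiard(2) [OF step off] unfolding billiard_states_def by blast
  next
    case False
    have "bounce n z u = Complex ((- \<sigma>) * real c * r) (\<rho> * r)"
      using False by (simp add: bounce_def u complex_eq_iff)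
    moreover have "of_int (- 2) * Re z \<in> grid n"
      using prefractal_vertical_side(1) [OF z False] by (rule grid_int_mult)
    from phases_minus [OF phases_add_grid [OF ph' this]]
    have "Re z - (- \<sigma>) * \<rho> * real c * Im z \<in> phases n \<alpha>" by (simp add: algebra_simps)
    moreover have "- \<sigma> \<in> {-1, 1}" using \<sigma> by auto
    ultimately show ?thesis
      using z \<rho> regular_step_billiard(2) [OF step off] unfolding billiard_states_def by blast
  qed
  with step regular_step_billiard(1) [OF step off] show ?thesis using that by blast
qed

text \<open>
  The incoming velocity is recovered from the outgoing one.  Both starting points then lie on the same
  backward ray, and the one closer to \<open>z\<close> would be an interior point of the flight of the other.
\<close>

lemma regular_step_injective:
  assumes "regular_step n (x1, u1) (z, v)" "regular_step n (x2, u2) (z, v)"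
    and "x1 \<in> prefractal n" "x2 \<in> prefractal n"
  shows "x1 = x2 \<and> u1 = u2"
proof -
  obtain T1 T2 where T: "T1 > 0" "z = x1 + T1 *\<^sub>R u1" "T2 > 0" "z = x2 + T2 *\<^sub>R u2"
    and in1: "\<And>t. 0 < t \<Longrightarrow> t < T1 \<Longrightarrow> x1 + t *\<^sub>R u1 \<in> prefractal_region n"
    and in2: "\<And>t. 0 < t \<Longrightarrow> t < T2 \<Longrightarrow> x2 + t *\<^sub>R u2 \<in> prefractal_region n"
    and v: "v = bounce n z u1" "v = bounce n z u2"
    using assms(1,2) unfolding regular_step_def prod.case by blast
  have u: "u2 = u1" using v by (auto simp: bounce_def split: if_splits)
  have notin: "x1 \<notin> prefractal_region n" "x2 \<notin> prefractal_region n"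
    using assms(3,4) by (simp_all add: prefractal_iff)
  have "T1 = T2"
  proof (rule linorder_cases)
    assume "T1 < T2"
    then have "x2 + (T2 - T1) *\<^sub>R u2 = x1" using T u by (simp add: algebra_simps)
    then show ?thesis using in2 [of "T2 - T1"] \<open>T1 < T2\<close> T(1) notin(1) by auto
  next
    assume "T2 < T1"
    then have "x1 + (T1 - T2) *\<^sub>R u1 = x2" using T u by (simp add: algebra_simps)
    then show ?thesis using in1 [of "T1 - T2"] \<open>T2 < T1\<close> T(3) notin(2) by auto
  qed
  with T u show ?thesis by simp
qed

text \<open>
  At a basepoint either \<open>x\<close> is on the grid and \<open>\<plusminus> c y\<close> is an admissible phase, or \<open>c y\<close> is on the grid
  and \<open>x\<close> is an admissible phase.  Both sets are discrete, and the region is bounded.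
\<close>

lemma finite_billiard_states:
  assumes "c > 0"
  shows "finite (billiard_states n c r \<alpha>)"
proof -
  obtain M where M: "\<And>x. x \<in> closed_region n \<Longrightarrow> norm x \<le> M"
    using compact_imp_bounded [OF compact_closed_region] bounded_iff by metis
  define B where "B = (grid n \<union> phases n \<alpha>) \<inter> {- (M + real c * M)..M + real c * M}"
  have "finite B" unfolding B_def Int_Un_distrib2
    by (intro finite_UnI finite_grid_interval finite_phases_interval)
  define V where "V = (\<lambda>(\<sigma>, \<rho>). Complex (\<sigma> * real c * r) (\<rho> * r)) ` ({-1, 1} \<times> {-1, 1})"
  have "finite V" by (simp add: V_def)
  have "billiard_states n c r \<alpha> \<subseteq> (\<lambda>(x, y). Complex x (y / real c)) ` (B \<times> B) \<times> V"
  proof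
    fix s assume "s \<in> billiard_states n c r \<alpha>"
    then obtain z u where "s = (z, u)" "(z, u) \<in> billiard_states n c r \<alpha>" by (cases s) simp
    then obtain \<sigma> \<rho> where z: "z \<in> prefractal n" and \<sigma>: "\<sigma> \<in> {-1, 1}" and \<rho>: "\<rho> \<in> {-1, 1}"
      and s: "s = (z, Complex (\<sigma> * real c * r) (\<rho> * r))"
      and ph: "Re z - \<sigma> * \<rho> * real c * Im z \<in> phases n \<alpha>"
      unfolding billiard_states_def mem_Collect_eq prod.case by blast
    have \<sigma>\<rho>: "\<sigma> * \<rho> = 1 \<or> \<sigma> * \<rho> = - 1" using \<sigma> \<rho> by auto
    have norm: "norm z \<le> M" using M z prefractal_subset by blast
    have "M \<ge> 0" using norm norm_ge_zero order_trans by blast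
    have "\<bar>Re z\<bar> \<le> M" "\<bar>Im z\<bar> \<le> M"
      using norm abs_Re_le_cmod [of z] abs_Im_le_cmod [of z] by linarith+
    moreover from this have "real c * \<bar>Im z\<bar> \<le> real c * M" by (intro mult_left_mono) auto
    then have "\<bar>real c * Im z\<bar> \<le> real c * M" by (simp add: abs_mult)
    moreover have "real c * M \<ge> 0" using \<open>M \<ge> 0\<close> by simp
    ultimately have bounds: "Re z \<in> {- (M + real c * M)..M + real c * M}"
      "real c * Im z \<in> {- (M + real c * M)..M + real c * M}"
      using \<open>M \<ge> 0\<close> by auto
    have "Re z \<in> grid n \<union> phases n \<alpha> \<and> real c * Im z \<in> grid n \<union> phases n \<alpha>"
    proof (cases "Im z \<in> grid n")
      case True
      have g: "real c * Im z \<in> grid n" using grid_int_mult [OF True, of "int c"] by simp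
      then have "\<sigma> * \<rho> * real c * Im z \<in> grid n" using \<sigma>\<rho> grid_minus [OF g] by auto
      from phases_add_grid [OF ph this] g show ?thesis by simp
    next
      case False
      have g: "Re z \<in> grid n" using prefractal_vertical_side(1) [OF z False] .
      from phases_add_grid [OF ph grid_minus [OF g]]
      have "- (\<sigma> * \<rho> * real c * Im z) \<in> phases n \<alpha>" by simp
      then have "real c * Im z \<in> phases n \<alpha>"
        using \<sigma>\<rho> phases_minus [of "- (real c * Im z)"] by auto
      with g show ?thesis by simp
    qed
    with bounds have "Re z \<in> B" "real c * Im z \<in> B" by (auto simp: B_def)
    moreover have "z = (\<lambda>(x, y). Complex x (y / real c)) (Re z, real c * Im z)"
      using \<open>c > 0\<close> by simp
    ultimately have "z \<in> (\<lambda>(x, y). Complex x (y / real c)) ` (B \<times> B)" by blast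
    moreover have "Complex (\<sigma> * real c * r) (\<rho> * r) \<in> V"
      unfolding V_def using \<sigma> \<rho> by (intro image_eqI [of _ _ "(\<sigma>, \<rho>)"]) auto
    ultimately show "s \<in> (\<lambda>(x, y). Complex x (y / real c)) ` (B \<times> B) \<times> V" by (simp add: s)
  qed
  then show ?thesis
    by (rule finite_subset) (use \<open>finite B\<close> \<open>finite V\<close> in auto)
qed

text \<open>
  The map is total and injective on a finite set, hence a permutation of it.
\<close>

theorem off_grid_orbit_periodic:
  assumes S: "(x, u) \<in> billiard_states n c r \<alpha>" and "\<alpha> \<notin> grid n" "c > 0" "r > 0"
  shows "\<exists>m\<ge>1. (billiard_step n ^^ m) (x, u) (x, u)"
proof -
  define S where "S = billiard_states n c r \<alpha>"
  have "\<exists>s'. regular_step n s s' \<and> s' \<in> S \<and> billiard_step n s s'" if "s \<in> S" for s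
  proof -
    have "(fst s, snd s) \<in> billiard_states n c r \<alpha>" using that by (simp add: S_def)
    from regular_step_states [OF this assms(2-)] show ?thesis by (metis S_def prod.collapse)
  qed
  then obtain f where f: "\<And>s. s \<in> S \<Longrightarrow> regular_step n s (f s)"
    "\<And>s. s \<in> S \<Longrightarrow> f s \<in> S" "\<And>s. s \<in> S \<Longrightarrow> billiard_step n s (f s)"
    by metis
  have "inj_on f S"
  proof (rule inj_onI)
    fix s s' assume ss: "s \<in> S" "s' \<in> S" "f s = f s'"
    have "fst s \<in> prefractal n" "fst s' \<in> prefractal n"
      using ss by (auto simp: S_def billiard_states_def)
    with f(1) [OF ss(1)] f(1) [OF ss(2)] ss(3)
      regular_step_injective [of n "fst s" "snd s" "fst (f s)" "snd (f s)" "fst s'" "snd s'"]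
    show "s = s'" by (simp add: prod_eq_iff)
  qed
  moreover have "finite S" unfolding S_def using assms by (intro finite_billiard_states)
  moreover have "f ` S \<subseteq> S" using f(2) by blast
  moreover have xu: "(x, u) \<in> S" using S by (simp add: S_def)
  ultimately obtain m where m: "m \<ge> 1" "(f ^^ m) (x, u) = (x, u)"
    using injective_on_finite_set_periodic by metis
  have "(f ^^ i) (x, u) \<in> S \<and> (billiard_step n ^^ i) (x, u) ((f ^^ i) (x, u))" for i
  proof (induction i)
    case (Suc i)
    then show ?case using f(2,3) by (metis funpow.simps(2) o_apply relpowp_Suc_I)
  qed (simp add: xu)
  with m show ?thesis by metis
qed

section \<open>Climbing through the tree of T-shapes\<close>

text \<open>
  The point with coordinates \<open>(x, y)\<close> relative to the T-shape of stage \<open>k\<close> at \<open>a\<close>: the stem is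
  \<open>[0,2] \<times> [0,2]\<close> and the bar is \<open>[-1,3] \<times> [2,3]\<close>, whatever the stage.
\<close>

definition loc :: "nat \<Rightarrow> complex \<Rightarrow> real \<Rightarrow> real \<Rightarrow> complex" where
  "loc k a x y = a + (1/2) ^ k *\<^sub>R Complex x y"

lemma Re_loc [simp]: "Re (loc k a x y) = Re a + (1/2) ^ k * x"
  and Im_loc [simp]: "Im (loc k a x y) = Im a + (1/2) ^ k * y"
  by (simp_all add: loc_def)

lemma loc_in_tshape:
  "loc k a x y \<in> tshape a ((1/2) ^ k) \<longleftrightarrow>
    (0 \<le> x \<and> x \<le> 2 \<and> 0 \<le> y \<and> y \<le> 2) \<or> (- 1 \<le> x \<and> x \<le> 3 \<and> 2 \<le> y \<and> y \<le> 3)"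
proof -
  define s :: real where "s = (1/2) ^ k"
  have "s > 0" by (simp add: s_def)
  have "0 \<le> s * x \<longleftrightarrow> 0 \<le> x" "0 \<le> s * y \<longleftrightarrow> 0 \<le> y" "- s \<le> s * x \<longleftrightarrow> - 1 \<le> x"
    using \<open>s > 0\<close> mult_le_cancel_left_pos [of s "- 1" x] by (simp_all add: zero_le_mult_iff)
  then show ?thesis
    unfolding s_def [symmetric] in_tshape_iff [OF \<open>s > 0\<close>] using \<open>s > 0\<close>
    by (simp add: s_def [symmetric] mult.commute [of _ s])
qed

lemma base_points_Suc_iff:
  "a \<in> base_points (Suc k) \<longleftrightarrow> (\<exists>b\<in>base_points k. \<exists>p\<in>{-1, 2}. a = loc k b p 3)"
  by (auto simp: loc_def)

lemma tshape_subset_closed_region: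
  "a \<in> base_points k \<Longrightarrow> k \<le> n \<Longrightarrow> tshape a ((1/2) ^ k) \<subseteq> closed_region n"
  unfolding closed_region_def by blast

lemma Im_base_point: "a \<in> base_points k \<Longrightarrow> Im a = 6 - 6 * (1/2) ^ k"
  by (induction k arbitrary: a) auto

text \<open>
  T-shapes of one stage are far apart: in units of their scale their positions differ by multiples of
  \<open>6\<close>, while the bars have width \<open>4\<close>.  This is why the walls of a T-shape remain on the boundary at all
  later stages.  In the induction step both positions are displaced by \<open>-1\<close> or \<open>2\<close> units of the parent,
  so their difference changes by a multiple of \<open>3\<close>, that is \<open>6\<close> units of the child.
\<close>

lemma base_points_spacing:
  "a \<in> base_points k \<Longrightarrow> b \<in> base_points k \<Longrightarrow> \<exists>i::int. Re b - Re a = (1/2) ^ k * (6 * of_int i)"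
proof (induction k arbitrary: a b)
  case (Suc k)
  from Suc.prems(1) obtain a' x where a: "a' \<in> base_points k" "a = loc k a' x 3" "x = -1 \<or> x = 2"
    unfolding base_points_Suc_iff by blast
  from Suc.prems(2) obtain b' y where b: "b' \<in> base_points k" "b = loc k b' y 3" "y = -1 \<or> y = 2"
    unfolding base_points_Suc_iff by blast
  obtain i where i: "Re b' - Re a' = (1/2) ^ k * (6 * of_int i)" using Suc.IH a b by blast
  define j :: int where "j = (if x = y then 0 else if x < y then 1 else - 1)"
  have j: "y - x = 3 * of_int j" using a(3) b(3) by (auto simp: j_def)
  have "Re b - Re a = (1/2) ^ k * (6 * of_int i + (y - x))"
    using i a(2) b(2) by (simp add: algebra_simps)
  also have "\<dots> = (1/2) ^ Suc k * (6 * of_int (2 * i + j))"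
    unfolding j by (simp add: algebra_simps)
  finally have "Re b - Re a = (1/2) ^ Suc k * (6 * of_int (2 * i + j))" .
  then show ?case by blast
qed simp

text \<open>
  Each stage occupies its own range of heights.
\<close>

lemma cross_section:
  assumes w: "w \<in> closed_region n" and "6 - 6 * (1/2) ^ k < Im w" "Im w < 6 - 3 * (1/2) ^ k"
  obtains b where "b \<in> base_points k" "w \<in> tshape b ((1/2) ^ k)"
proof -
  obtain j b where b: "b \<in> base_points j" "w \<in> tshape b ((1/2) ^ j)"
    using w unfolding closed_region_def by blast
  then have Im: "6 - 6 * (1/2) ^ j \<le> Im w" "Im w \<le> 6 - 3 * (1/2) ^ j"
    using Im_base_point [OF b(1)] by (auto simp: in_tshape_iff)
  have half: "(1/2::real) ^ q \<le> (1/2) * (1/2) ^ p" if "p < q" for p q :: nat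
    using power_decreasing [of "Suc p" q "1/2 :: real"] that by simp
  have "j = k"
  proof (rule linorder_cases)
    assume "j < k" with half [OF this] Im assms show ?thesis by linarith
  next
    assume "k < j" with half [OF this] Im assms show ?thesis by linarith
  qed
  with b that show ?thesis by blast
qed

lemma open_box_in_region:
  assumes "\<And>x y. x1 < x \<Longrightarrow> x < x2 \<Longrightarrow> y1 < y \<Longrightarrow> y < y2 \<Longrightarrow> loc k a x y \<in> closed_region n"
    and "x1 < x" "x < x2" "y1 < y" "y < y2"
  shows "loc k a x y \<in> prefractal_region n"
  unfolding prefractal_region_def
proof (rule interiorI)
  show "open (box (loc k a x1 y1) (loc k a x2 y2))" by (rule open_box)
  show "loc k a x y \<in> box (loc k a x1 y1) (loc k a x2 y2)"
    using assms by (simp add: in_box_complex_iff)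
  show "box (loc k a x1 y1) (loc k a x2 y2) \<subseteq> closed_region n"
  proof
    fix w assume w: "w \<in> box (loc k a x1 y1) (loc k a x2 y2)"
    define p q where "p = 2 ^ k * (Re w - Re a)" and "q = 2 ^ k * (Im w - Im a)"
    have pq: "Re w = Re a + (1/2) ^ k * p" "Im w = Im a + (1/2) ^ k * q"
      by (simp_all add: p_def q_def power_one_over)
    then have "w = loc k a p q" by (simp add: complex_eq_iff)
    moreover have "x1 < p" "p < x2" "y1 < q" "q < y2"
      using w by (simp_all add: in_box_complex_iff pq)
    ultimately show "w \<in> closed_region n" using assms(1) by simp
  qed
qed

lemma stem_and_bar_in_region:
  assumes "a \<in> base_points k" "k \<le> n"
  shows "0 < x \<Longrightarrow> x < 2 \<Longrightarrow> 0 < y \<Longrightarrow> y < 3 \<Longrightarrow> loc k a x y \<in> prefractal_region n"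
    and "- 1 < x \<Longrightarrow> x < 3 \<Longrightarrow> 2 < y \<Longrightarrow> y < 3 \<Longrightarrow> loc k a x y \<in> prefractal_region n"
proof -
  have *: "loc k a x y \<in> closed_region n"
    if "(0 \<le> x \<and> x \<le> 2 \<and> 0 \<le> y \<and> y \<le> 2) \<or> (- 1 \<le> x \<and> x \<le> 3 \<and> 2 \<le> y \<and> y \<le> 3)" for x y
    using loc_in_tshape tshape_subset_closed_region [OF assms] that by blast
  show "0 < x \<Longrightarrow> x < 2 \<Longrightarrow> 0 < y \<Longrightarrow> y < 3 \<Longrightarrow> loc k a x y \<in> prefractal_region n"
    by (rule open_box_in_region [of 0 2 0 3]) (auto intro!: *)
  show "- 1 < x \<Longrightarrow> x < 3 \<Longrightarrow> 2 < y \<Longrightarrow> y < 3 \<Longrightarrow> loc k a x y \<in> prefractal_region n"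
    by (rule open_box_in_region [of "-1" 3 2 3]) (auto intro!: *)
qed

lemma loc_child: "loc (Suc k) (loc k a p 3) x y = loc k a (p + x / 2) (3 + y / 2)"
  by (simp add: complex_eq_iff algebra_simps)

text \<open>
  The glued base segment between a bar and a T-shape on top of it is interior: the bar below
  together with the stem above covers a full rectangle around it.  In the coordinates of the
  bar that stem has height \<open>1\<close>.
\<close>

lemma junction_in_region:
  assumes a: "a \<in> base_points k" "Suc k \<le> n" and p: "p \<in> {-1, 2}"
    and "p < x" "x < p + 1" "2 < y" "y < 4"
  shows "loc k a x y \<in> prefractal_region n"
proof (rule open_box_in_region [of p "p + 1" 2 4])
  fix x y :: real assume xy: "p < x" "x < p + 1" "2 < y" "y < 4"
  show "loc k a x y \<in> closed_region n"
  proof (cases "y \<le> 3")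
    case True
    then have "loc k a x y \<in> tshape a ((1/2) ^ k)" using xy p by (auto simp: loc_in_tshape)
    then show ?thesis using tshape_subset_closed_region [OF a(1), of n] a(2) by auto
  next
    case False
    have child: "loc k a p 3 \<in> base_points (Suc k)"
      unfolding base_points_Suc_iff using a(1) p by blast
    have "loc (Suc k) (loc k a p 3) (2 * (x - p)) (2 * (y - 3)) \<in> tshape (loc k a p 3) ((1/2) ^ Suc k)"
      unfolding loc_in_tshape using False xy by auto
    then have "loc (Suc k) (loc k a p 3) (2 * (x - p)) (2 * (y - 3)) \<in> closed_region n"
      using tshape_subset_closed_region [OF child a(2)] by blast
    then show ?thesis by (simp add: loc_child diff_divide_distrib)
  qed
qed (use assms in auto)

text \<open>
  Points next to a wall, displaced by \<open>d * h\<close>, have the same height as the point on the wall, so only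
  T-shapes of the same stage could contain them.
\<close>

lemma side_not_in_region:
  assumes a: "a \<in> base_points k" and y: "0 < y" "y < 3"
    and out: "\<And>h b. 0 < h \<Longrightarrow> h < 1 \<Longrightarrow> b \<in> base_points k \<Longrightarrow> loc k a (x + d * h) y \<notin> tshape b ((1/2) ^ k)"
  shows "loc k a x y \<notin> prefractal_region n"
proof
  assume "loc k a x y \<in> prefractal_region n"
  then obtain e where "e > 0" and e: "ball (loc k a x y) e \<subseteq> closed_region n"
    unfolding prefractal_region_def mem_interior by blast
  \<comment> \<open>Close enough to the wall to stay within \<open>e\<close> at every scale \<open>(1/2) ^ k \<le> 1\<close>.\<close>
  define h where "h = min (1/2) (e / (2 * (\<bar>d\<bar> + 1)))"
  have h: "0 < h" "h < 1" "h * (\<bar>d\<bar> + 1) < e"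
  proof -
    show "0 < h" using \<open>e > 0\<close> by (simp add: h_def add_nonneg_pos)
    show "h < 1" by (auto simp: h_def min_def)
    have "h * (\<bar>d\<bar> + 1) \<le> e / (2 * (\<bar>d\<bar> + 1)) * (\<bar>d\<bar> + 1)"
      by (intro mult_right_mono) (auto simp: h_def)
    also have "\<dots> = e / 2" by (simp add: field_simps add_nonneg_pos) 
    finally show "h * (\<bar>d\<bar> + 1) < e" using \<open>e > 0\<close> by linarith
  qed
  have "loc k a (x + d * h) y - loc k a x y = of_real ((1/2) ^ k * (h * d))"
    by (simp add: complex_eq_iff algebra_simps)
  then have "dist (loc k a x y) (loc k a (x + d * h) y) = (1/2) ^ k * (h * \<bar>d\<bar>)"
    using h(1) by (simp only: dist_norm norm_minus_commute [of "loc k a x y"] norm_of_real) (simp add: abs_mult)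
  also have "\<dots> \<le> 1 * (h * \<bar>d\<bar>)"
    using h(1) by (intro mult_right_mono) (auto simp: power_le_one)
  also have "\<dots> < e" using h by (simp add: algebra_simps)
  finally have "loc k a (x + d * h) y \<in> closed_region n" using e by auto
  moreover have "(1/2) ^ k * y < (1/2 :: real) ^ k * 3" "0 < (1/2 :: real) ^ k * y" using y by simp_all
  then have "6 - 6 * (1/2) ^ k < Im (loc k a (x + d * h) y)" "Im (loc k a (x + d * h) y) < 6 - 3 * (1/2) ^ k"
    unfolding Im_loc Im_base_point [OF a] by linarith+
  ultimately obtain b where "b \<in> base_points k" "loc k a (x + d * h) y \<in> tshape b ((1/2) ^ k)"
    by (rule cross_section)
  with out h show False by blast
qed

lemma loc_in_other_tshape:
  assumes "a \<in> base_points k" "b \<in> base_points k"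
  obtains i :: int where "\<And>x y. loc k a x y \<in> tshape b ((1/2) ^ k) \<longleftrightarrow>
    (0 \<le> x - 6 * i \<and> x - 6 * i \<le> 2 \<and> 0 \<le> y \<and> y \<le> 2) \<or>
    (- 1 \<le> x - 6 * i \<and> x - 6 * i \<le> 3 \<and> 2 \<le> y \<and> y \<le> 3)"
proof -
  obtain i :: int where i: "Re b - Re a = (1/2) ^ k * (6 * of_int i)"
    using base_points_spacing [OF assms] by blast
  have "loc k a x y = loc k b (x - 6 * i) y" for x y
    using i Im_base_point [OF assms(1)] Im_base_point [OF assms(2)]
    by (simp add: complex_eq_iff algebra_simps)
  then show ?thesis using that [of i] by (simp add: loc_in_tshape)
qed

lemma stem_side_not_in_region:
  assumes a: "a \<in> base_points k" and y: "0 < y" "y < 2" and \<sigma>: "\<sigma> \<in> {-1, 1}"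
  shows "loc k a (1 + \<sigma>) y \<notin> prefractal_region n"
proof (rule side_not_in_region [OF a y(1), where d = \<sigma>])
  fix h :: real and b assume h: "0 < h" "h < 1" and b: "b \<in> base_points k"
  obtain i :: int where i: "\<And>x y. loc k a x y \<in> tshape b ((1/2) ^ k) \<longleftrightarrow>
    (0 \<le> x - 6 * i \<and> x - 6 * i \<le> 2 \<and> 0 \<le> y \<and> y \<le> 2) \<or>
    (- 1 \<le> x - 6 * i \<and> x - 6 * i \<le> 3 \<and> 2 \<le> y \<and> y \<le> 3)"
    using loc_in_other_tshape [OF a b] by metis
  have "i \<le> -1 \<or> i = 0 \<or> i \<ge> 1" by linarith
  then show "loc k a (1 + \<sigma> + \<sigma> * h) y \<notin> tshape b ((1/2) ^ k)"
    unfolding i using h y \<sigma> by auto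
qed (use y in auto)

lemma bar_side_not_in_region:
  assumes a: "a \<in> base_points k" and y: "2 < y" "y < 3" and \<sigma>: "\<sigma> \<in> {-1, 1}"
  shows "loc k a (1 + 2 * \<sigma>) y \<notin> prefractal_region n"
proof (rule side_not_in_region [OF a, where d = \<sigma>])
  fix h :: real and b assume h: "0 < h" "h < 1" and b: "b \<in> base_points k"
  obtain i :: int where i: "\<And>x y. loc k a x y \<in> tshape b ((1/2) ^ k) \<longleftrightarrow>
    (0 \<le> x - 6 * i \<and> x - 6 * i \<le> 2 \<and> 0 \<le> y \<and> y \<le> 2) \<or>
    (- 1 \<le> x - 6 * i \<and> x - 6 * i \<le> 3 \<and> 2 \<le> y \<and> y \<le> 3)"
    using loc_in_other_tshape [OF a b] by metis
  have "i \<le> -1 \<or> i = 0 \<or> i \<ge> 1" by linarith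
  then show "loc k a (1 + 2 * \<sigma> + \<sigma> * h) y \<notin> tshape b ((1/2) ^ k)"
    unfolding i using h y \<sigma> by auto
qed (use y in auto)

section \<open>Upward flights from side to side\<close>

text \<open>
  Upward directions are normalised to vertical component \<open>1\<close>, so that flight time is the height gained.
\<close>

definition heading :: "nat \<Rightarrow> real \<Rightarrow> complex" where
  "heading c \<sigma> = Complex (\<sigma> * real c) 1"

text \<open>
  All stages from \<open>k\<close> on are treated at once because one path has to serve the orbits of all of them.
\<close>

definition flies :: "nat \<Rightarrow> nat \<Rightarrow> real \<Rightarrow> complex \<Rightarrow> complex \<Rightarrow> bool" where
  "flies c k \<sigma> z z' \<longleftrightarrow> (\<exists>T>0. z' = z + T *\<^sub>R heading c \<sigma> \<and>
     (\<forall>n\<ge>k. \<forall>t. 0 < t \<and> t < T \<longrightarrow> z + t *\<^sub>R heading c \<sigma> \<in> prefractal_region n))"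

lemma flies_mono: "flies c k \<sigma> z z' \<Longrightarrow> k \<le> k' \<Longrightarrow> flies c k' \<sigma> z z'"
  unfolding flies_def by (elim exE conjE, intro exI conjI) (assumption, assumption, auto)

lemma flies_trans:
  assumes "flies c k \<sigma> z z'" "flies c k \<sigma> z' z''" and z': "\<And>n. k \<le> n \<Longrightarrow> z' \<in> prefractal_region n"
  shows "flies c k \<sigma> z z''"
proof -
  obtain T where T: "T > 0" "z' = z + T *\<^sub>R heading c \<sigma>"
    "\<And>n t. k \<le> n \<Longrightarrow> 0 < t \<Longrightarrow> t < T \<Longrightarrow> z + t *\<^sub>R heading c \<sigma> \<in> prefractal_region n"
    using assms(1) unfolding flies_def by blast
  obtain T' where T': "T' > 0" "z'' = z' + T' *\<^sub>R heading c \<sigma>"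
    "\<And>n t. k \<le> n \<Longrightarrow> 0 < t \<Longrightarrow> t < T' \<Longrightarrow> z' + t *\<^sub>R heading c \<sigma> \<in> prefractal_region n"
    using assms(2) unfolding flies_def by blast
  have "z + t *\<^sub>R heading c \<sigma> \<in> prefractal_region n" if "k \<le> n" "0 < t" "t < T + T'" for n t
  proof -
    consider "t < T" | "t = T" | "t > T" by linarith
    then show ?thesis
    proof cases
      case 3
      have "z + t *\<^sub>R heading c \<sigma> = z' + (t - T) *\<^sub>R heading c \<sigma>"
        by (simp add: T(2) algebra_simps)
      with T'(3) [of n "t - T"] that 3 show ?thesis by simp
    qed (use T z' that in auto)
  qed
  moreover have "z'' = z + (T + T') *\<^sub>R heading c \<sigma>"
    by (simp add: T(2) T'(2) algebra_simps)
  ultimately show ?thesis unfolding flies_def using T(1) T'(1)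
    by (intro exI [of _ "T + T'"]) auto
qed

lemma flies_loc:
  assumes "\<tau> > 0" "x' = x + \<sigma> * c * \<tau>" "y' = y + \<tau>"
    and "\<And>n t. k' \<le> n \<Longrightarrow> 0 < t \<Longrightarrow> t < \<tau> \<Longrightarrow> loc k a (x + \<sigma> * c * t) (y + t) \<in> prefractal_region n"
  shows "flies c k' \<sigma> (loc k a x y) (loc k a x' y')"
proof -
  define s :: real where "s = (1/2) ^ k"
  have "s > 0" by (simp add: s_def)
  have move: "loc k a x y + (s * t) *\<^sub>R heading c \<sigma> = loc k a (x + \<sigma> * c * t) (y + t)" for t
    by (simp add: complex_eq_iff heading_def s_def algebra_simps)
  show ?thesis unfolding flies_def
  proof (intro exI [of _ "s * \<tau>"] conjI allI impI)
    show "s * \<tau> > 0" using \<open>s > 0\<close> assms(1) by simp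
    show "loc k a x' y' = loc k a x y + (s * \<tau>) *\<^sub>R heading c \<sigma>"
      unfolding move assms(2,3) ..
    fix n t assume n: "k' \<le> n" and t: "0 < t \<and> t < s * \<tau>"
    have "loc k a x y + t *\<^sub>R heading c \<sigma> = loc k a x y + (s * (t / s)) *\<^sub>R heading c \<sigma>"
      using \<open>s > 0\<close> by simp
    also have "\<dots> = loc k a (x + \<sigma> * c * (t / s)) (y + t / s)" by (rule move)
    also have "\<dots> \<in> prefractal_region n"
      using t \<open>s > 0\<close> n by (intro assms(4)) (auto simp: pos_divide_less_eq mult.commute)
    finally show "loc k a x y + t *\<^sub>R heading c \<sigma> \<in> prefractal_region n" .
  qed
qed

text \<open>
  States of an upward trajectory inside a T-shape.  The quantities \<open>1 - \<sigma> (x - 1)\<close> and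
  \<open>2 - \<sigma> (x - 1)\<close> are the horizontal distances to the wall ahead, at \<open>1 + \<sigma>\<close> in the stem and at
  \<open>1 + 2 \<sigma>\<close> in the bar.  In the bar the last condition says that the straight continuation up to the
  top of the unfolded bar, with the origin moved to its left end, comes within distance \<open>1\<close> of a
  multiple of \<open>4\<close>, that is, of an image of one of the ends of the bar.  It is invariant under
  reflection in the sides of the bar.
\<close>

definition in_stem :: "real \<Rightarrow> real \<Rightarrow> real \<Rightarrow> bool" where
  "in_stem x y \<sigma> \<longleftrightarrow> 0 < 1 - \<sigma> * (x - 1) \<and> 1 - \<sigma> * (x - 1) \<le> 2 \<and> 0 \<le> y \<and> y < 2"

definition in_bar :: "nat \<Rightarrow> real \<Rightarrow> real \<Rightarrow> real \<Rightarrow> bool" where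
  "in_bar c x y \<sigma> \<longleftrightarrow> 0 < 2 - \<sigma> * (x - 1) \<and> 2 - \<sigma> * (x - 1) \<le> 4 \<and> 2 \<le> y \<and> y < 3 \<and>
     (\<exists>j::int. \<bar>x + 1 + \<sigma> * c * (3 - y) - 4 * of_int j\<bar> < 1)"

text \<open>
  A climbing state has a phase that is not dyadic.  This property does not depend on the T-shape in
  whose coordinates the phase is computed, and it keeps the trajectory away from all corners.
\<close>

definition climbs :: "nat \<Rightarrow> nat \<Rightarrow> complex \<Rightarrow> real \<Rightarrow> bool" where
  "climbs c k z \<sigma> \<longleftrightarrow> \<sigma> \<in> {-1, 1} \<and> (\<exists>a\<in>base_points k. \<exists>x y. z = loc k a x y \<and>
     x - \<sigma> * c * y \<notin> dyadic \<and> (in_stem x y \<sigma> \<or> in_bar c x y \<sigma>))"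

definition climbs_off_side :: "nat \<Rightarrow> nat \<Rightarrow> complex \<Rightarrow> real \<Rightarrow> bool" where
  "climbs_off_side c k z \<sigma> \<longleftrightarrow> climbs c k z \<sigma> \<and> (\<forall>n\<ge>k. z \<in> prefractal n) \<and> Im z \<notin> dyadic"

lemma sign_mult_dyadic: "\<sigma> \<in> {-1, 1} \<Longrightarrow> y \<in> dyadic \<Longrightarrow> \<sigma> * real c * y \<in> dyadic"
  by (intro dyadic_mult) (auto intro: dyadic_minus)

lemma Im_loc_dyadic_iff:
  assumes "a \<in> base_points k" shows "Im (loc k a x y) \<in> dyadic \<longleftrightarrow> y \<in> dyadic"
proof -
  have 6: "6 - 6 * (1/2) ^ k \<in> dyadic" by (intro dyadic_diff dyadic_mult) simp_all
  have "Im (loc k a x y) = (6 - 6 * (1/2) ^ k) + (1/2) ^ k * y" using Im_base_point [OF assms] by simp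
  then have "Im (loc k a x y) \<in> dyadic \<longleftrightarrow> (1/2) ^ k * y \<in> dyadic"
    using dyadic_add [OF 6, of "(1/2) ^ k * y"] dyadic_diff [OF _ 6, of "Im (loc k a x y)"] by auto
  then show ?thesis by simp
qed

text \<open>
  Reflection in a wall \<open>x'\<close> turns the phase \<open>p\<close> into \<open>2 * x' - p\<close>, which is again not dyadic as \<open>x'\<close>
  is an integer.  For the same reason the height of the point is not dyadic: the point is no corner.
\<close>

lemma climbs_off_sideI:
  assumes a: "a \<in> base_points k" and \<sigma>: "\<sigma> \<in> {-1, 1}" and line: "x - \<sigma> * real c * y \<notin> dyadic" "x' = x + \<sigma> * c * \<tau>" "y' = y + \<tau>"
    and side: "(x' = 1 + \<sigma> \<and> 0 < y' \<and> y' < 2) \<or> (x' = 1 + 2 * \<sigma> \<and> 2 < y' \<and> y' < 3)"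
    and "in_stem x' y' (- \<sigma>) \<or> in_bar c x' y' (- \<sigma>)"
  shows "climbs_off_side c k (loc k a x' y') (- \<sigma>)"
proof -
  have x': "x' \<in> dyadic" using side \<sigma> dyadic_of_int [of "-1"] by auto
  have const: "x' - \<sigma> * real c * y' = x - \<sigma> * real c * y" by (simp add: line algebra_simps)
  have y': "y' \<notin> dyadic"
  proof
    assume "y' \<in> dyadic"
    from dyadic_diff [OF x' sign_mult_dyadic [OF \<sigma> this, of c]] line(1) show False
      by (simp add: const)
  qed
  have "x' - (- \<sigma>) * real c * y' \<notin> dyadic"
  proof
    assume "x' - (- \<sigma>) * real c * y' \<in> dyadic"
    with x' have "2 * x' - (x' - (- \<sigma>) * real c * y') \<in> dyadic"
      by (rule dyadic_diff [OF dyadic_mult [OF dyadic_numeral(1)]])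
    also have "2 * x' - (x' - (- \<sigma>) * real c * y') = x - \<sigma> * real c * y"
      using const by (simp add: algebra_simps)
    finally show False using line(1) by simp
  qed
  then have "climbs c k (loc k a x' y') (- \<sigma>)"
    unfolding climbs_def using a \<sigma> assms(7) by auto
  moreover have "loc k a x' y' \<in> prefractal n" if "k \<le> n" for n
  proof -
    have "loc k a x' y' \<in> tshape a ((1/2) ^ k)"
      unfolding loc_in_tshape using side \<sigma> by auto
    then have "loc k a x' y' \<in> closed_region n"
      using tshape_subset_closed_region [OF a that] by blast
    moreover have "loc k a x' y' \<notin> prefractal_region n"
      using side stem_side_not_in_region [OF a _ _ \<sigma>] bar_side_not_in_region [OF a _ _ \<sigma>] by blast
    ultimately show ?thesis by (simp add: prefractal_iff)
  qed
  ultimately show ?thesis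
    using y' Im_loc_dyadic_iff [OF a] by (simp add: climbs_off_side_def)
qed

text \<open>
  The last conclusion of the second case excludes that case for a trajectory that starts at the base
  (\<open>y = 0\<close>) when \<open>c \<ge> 2\<close>: it must hit a wall of the stem.
\<close>

lemma stem_flight:
  assumes a: "a \<in> base_points k" and \<sigma>: "\<sigma> \<in> {-1, 1}" and gen: "x - \<sigma> * real c * y \<notin> dyadic"
    and stem: "in_stem x y \<sigma>" and "c > 0"
  obtains (side) z' where "flies c k \<sigma> (loc k a x y) z'" "climbs_off_side c k z' (- \<sigma>)"
    | (bar) x' where "0 < x'" "x' < 2" "flies c k \<sigma> (loc k a x y) (loc k a x' 2)"
        "x' - \<sigma> * real c * 2 \<notin> dyadic" "y + 2 / real c > 2"
proof -
  define d where "d = 1 - \<sigma> * (x - 1)"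
  have d: "0 < d" "d \<le> 2" and y: "0 \<le> y" "y < 2" using stem by (auto simp: in_stem_def d_def)
  have "\<sigma> * \<sigma> = 1" using \<sigma> by auto
  then have x: "x + \<sigma> * d = 1 + \<sigma>" by (simp add: d_def algebra_simps flip: mult.assoc)
  have inside: "0 < x + \<sigma> * c * t \<and> x + \<sigma> * c * t < 2" if "0 < t" "t < d / c" for t
  proof -
    have "0 < c * t" "c * t < d" using that \<open>c > 0\<close> by (auto simp: pos_less_divide_eq mult.commute)
    then show ?thesis using \<sigma> x d by (auto simp: mult.assoc)
  qed
  consider "y + d / c < 2" | "y + d / c = 2" | "y + d / c > 2" by linarith
  then show ?thesis
  proof cases
    case 1
    have pos: "d / c > 0" using d \<open>c > 0\<close> by simp
    have stop: "1 + \<sigma> = x + \<sigma> * c * (d / c)" using x \<open>c > 0\<close> by simp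
    have "flies c k \<sigma> (loc k a x y) (loc k a (1 + \<sigma>) (y + d / c))"
    proof (rule flies_loc [OF pos stop refl])
      fix n t assume "k \<le> n" "0 < t" "t < d / c"
      with inside [of t] 1 y show "loc k a (x + \<sigma> * c * t) (y + t) \<in> prefractal_region n"
        by (intro stem_and_bar_in_region(1) [OF a]) auto
    qed
    moreover have "climbs_off_side c k (loc k a (1 + \<sigma>) (y + d / c)) (- \<sigma>)"
    proof (rule climbs_off_sideI [OF a \<sigma> gen stop refl])
      show "1 + \<sigma> = 1 + \<sigma> \<and> 0 < y + d / c \<and> y + d / c < 2 \<or> 1 + \<sigma> = 1 + 2 * \<sigma> \<and> 2 < y + d / c \<and> y + d / c < 3"
        using 1 pos y by auto
      show "in_stem (1 + \<sigma>) (y + d / c) (- \<sigma>) \<or> in_bar c (1 + \<sigma>) (y + d / c) (- \<sigma>)"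
        using 1 pos y \<sigma> by (auto simp: in_stem_def)
    qed
    ultimately show ?thesis by (rule side)
  next
    case 2
    have "d = c * (2 - y)" using 2 \<open>c > 0\<close> by (auto simp: field_simps)
    then have "x + \<sigma> * (c * (2 - y)) = 1 + \<sigma>" using x by simp
    then have "x - \<sigma> * real c * y = 1 + \<sigma> - \<sigma> * real c * 2" by (simp add: algebra_simps)
    moreover have "1 + \<sigma> - \<sigma> * real c * 2 \<in> dyadic"
      using \<sigma> by (intro dyadic_diff dyadic_add sign_mult_dyadic) (auto intro: dyadic_minus)
    ultimately show ?thesis using gen by simp
  next
    case 3
    have "d / c \<le> 2 / c" using d by (intro divide_right_mono) auto
    with 3 have far: "y + 2 / c > 2" by linarith
    have in2: "0 < x + \<sigma> * c * (2 - y) \<and> x + \<sigma> * c * (2 - y) < 2"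
      using inside [of "2 - y"] 3 y by linarith
    have "flies c k \<sigma> (loc k a x y) (loc k a (x + \<sigma> * c * (2 - y)) 2)"
    proof (rule flies_loc [where \<tau> = "2 - y"])
      fix n t assume "k \<le> n" "0 < t" "t < 2 - y"
      with inside [of t] 3 y show "loc k a (x + \<sigma> * c * t) (y + t) \<in> prefractal_region n"
        by (intro stem_and_bar_in_region(1) [OF a]) auto
    qed (use y in auto)
    moreover have "x + \<sigma> * c * (2 - y) - \<sigma> * c * 2 \<notin> dyadic"
      using gen by (simp add: algebra_simps)
    ultimately show ?thesis using bar [of "x + \<sigma> * c * (2 - y)"] in2 far by auto
  qed
qed

text \<open>
  Here the congruence of \<open>c\<close> modulo \<open>4\<close> is used: \<open>x + 1\<close> is within distance \<open>1\<close> of \<open>2\<close>, and adding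
  \<open>\<sigma> c\<close> moves it to within distance \<open>1\<close> of a multiple of \<open>4\<close>.
\<close>

lemma bar_entry:
  assumes "c mod 4 = 2" "\<sigma> \<in> {-1, 1}" "0 < x" "x < 2"
  shows "in_bar c x 2 \<sigma>"
proof -
  obtain m where c: "c = 4 * m + 2" using assms(1) by (metis mult_div_mod_eq)
  have "\<exists>j::int. \<bar>x + 1 + \<sigma> * c * (3 - 2) - 4 * of_int j\<bar> < 1"
  proof (cases "\<sigma> = 1")
    case True
    then show ?thesis using assms by (intro exI [of _ "int m + 1"]) (auto simp: c)
  next
    case False
    then show ?thesis using assms by (intro exI [of _ "- int m"]) (auto simp: c)
  qed
  then show ?thesis using assms by (auto simp: in_bar_def)
qed

text \<open>
  If the trajectory reaches the top of the bar at \<open>x3\<close>, then \<open>x3 + 1\<close> lies between \<open>0\<close> and \<open>4\<close> and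
  within distance \<open>1\<close> of a multiple of \<open>4\<close>, so \<open>x3\<close> is in one of the two outer quarters.
\<close>

lemma bar_flight:
  assumes a: "a \<in> base_points k" and \<sigma>: "\<sigma> \<in> {-1, 1}" and gen: "x - \<sigma> * real c * y \<notin> dyadic"
    and bar: "in_bar c x y \<sigma>" and "c > 0"
  obtains (side) z' where "flies c k \<sigma> (loc k a x y) z'" "climbs_off_side c k z' (- \<sigma>)"
    | (child) b x' where "b \<in> base_points (Suc k)" "0 < x'" "x' < 2"
        "flies c (Suc k) \<sigma> (loc k a x y) (loc (Suc k) b x' 0)" "x' \<notin> dyadic"
        "\<And>n. Suc k \<le> n \<Longrightarrow> loc (Suc k) b x' 0 \<in> prefractal_region n"
proof -
  define d where "d = 2 - \<sigma> * (x - 1)"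
  have d: "0 < d" "d \<le> 4" and y: "2 \<le> y" "y < 3" using bar by (auto simp: in_bar_def d_def)
  obtain j :: int where j: "\<bar>x + 1 + \<sigma> * c * (3 - y) - 4 * of_int j\<bar> < 1"
    using bar by (auto simp: in_bar_def)
  have "\<sigma> * \<sigma> = 1" using \<sigma> by auto
  then have x: "x + \<sigma> * d = 1 + 2 * \<sigma>" by (simp add: d_def algebra_simps flip: mult.assoc)
  have inside: "- 1 < x + \<sigma> * c * t \<and> x + \<sigma> * c * t < 3" if "0 < t" "t < d / c" for t
  proof -
    have "0 < c * t" "c * t < d" using that \<open>c > 0\<close> by (auto simp: pos_less_divide_eq mult.commute)
    then show ?thesis using \<sigma> x d by (auto simp: mult.assoc)
  qed
  consider "y + d / c < 3" | "y + d / c = 3" | "y + d / c > 3" by linarith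
  then show ?thesis
  proof cases
    case 1
    have pos: "d / c > 0" using d \<open>c > 0\<close> by simp
    have stop: "1 + 2 * \<sigma> = x + \<sigma> * c * (d / c)" using x \<open>c > 0\<close> by simp
    have "flies c k \<sigma> (loc k a x y) (loc k a (1 + 2 * \<sigma>) (y + d / c))"
    proof (rule flies_loc [OF pos stop refl])
      fix n t assume "k \<le> n" "0 < t" "t < d / c"
      with inside [of t] 1 y show "loc k a (x + \<sigma> * c * t) (y + t) \<in> prefractal_region n"
        by (intro stem_and_bar_in_region(2) [OF a]) auto
    qed
    moreover have "climbs_off_side c k (loc k a (1 + 2 * \<sigma>) (y + d / c)) (- \<sigma>)"
    proof (rule climbs_off_sideI [OF a \<sigma> gen stop refl])
      show "1 + 2 * \<sigma> = 1 + \<sigma> \<and> 0 < y + d / c \<and> y + d / c < 2 \<or>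
          1 + 2 * \<sigma> = 1 + 2 * \<sigma> \<and> 2 < y + d / c \<and> y + d / c < 3"
        using 1 pos y by auto
      have "1 + 2 * \<sigma> + 1 + \<sigma> * c * (3 - (y + d / c)) = x + 1 + \<sigma> * c * (3 - y)"
        using stop by (simp add: algebra_simps)
      with j have j': "\<bar>1 + 2 * \<sigma> + 1 + \<sigma> * c * (3 - (y + d / c)) - 4 * of_int j\<bar> < 1" by simp
      \<comment> \<open>The unfolded position at the top changes its sign up to the shift \<open>2 * (x' + 1)\<close>, which is \<open>8\<close> or \<open>0\<close>.\<close>
      define i :: int where "i = (if \<sigma> = 1 then 2 - j else - j)"
      have "\<bar>1 + 2 * \<sigma> + 1 + (- \<sigma>) * c * (3 - (y + d / c)) - 4 * of_int i\<bar> < 1"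
        using j' \<sigma> by (auto simp: i_def)
      then show "in_stem (1 + 2 * \<sigma>) (y + d / c) (- \<sigma>) \<or> in_bar c (1 + 2 * \<sigma>) (y + d / c) (- \<sigma>)"
        using 1 pos y \<sigma> by (auto simp: in_bar_def)
    qed
    ultimately show ?thesis by (rule side)
  next
    case 2
    have "d = c * (3 - y)" using 2 \<open>c > 0\<close> by (auto simp: field_simps)
    then have "x + \<sigma> * (c * (3 - y)) = 1 + 2 * \<sigma>" using x by simp
    then have "x - \<sigma> * real c * y = 1 + 2 * \<sigma> - \<sigma> * real c * 3" by (simp add: algebra_simps)
    moreover have "1 + 2 * \<sigma> - \<sigma> * real c * 3 \<in> dyadic"
      using \<sigma> by (intro dyadic_diff dyadic_add sign_mult_dyadic dyadic_mult) (auto intro: dyadic_minus)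
    ultimately show ?thesis using gen by simp
  next
    case 3
    define x3 where "x3 = x + \<sigma> * c * (3 - y)"
    have in3: "- 1 < x3" "x3 < 3"
      using inside [of "3 - y"] 3 y unfolding x3_def by linarith+
    have "\<bar>x3 + 1 - 4 * of_int j\<bar> < 1" using j by (simp add: x3_def algebra_simps)
    moreover have "j \<le> -1 \<or> j = 0 \<or> j = 1 \<or> j \<ge> 2" by linarith
    ultimately have "x3 < 0 \<or> 2 < x3" using in3 by (elim disjE) linarith+
    then obtain p where p: "p \<in> {-1, 2}" "p < x3" "x3 < p + 1" using in3 by fastforce
    define b where "b = loc k a p 3"
    have eq: "loc (Suc k) b (2 * (x3 - p)) 0 = loc k a x3 3"
      by (simp add: b_def loc_child diff_divide_distrib)
    have reg: "loc k a x3 3 \<in> prefractal_region n" if "Suc k \<le> n" for n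
      using junction_in_region [OF a that p(1)] p by auto
    have "flies c (Suc k) \<sigma> (loc k a x y) (loc k a x3 3)"
    proof (rule flies_loc [where \<tau> = "3 - y"])
      fix n t assume "Suc k \<le> n" "0 < t" "t < 3 - y"
      with inside [of t] 3 y show "loc k a (x + \<sigma> * c * t) (y + t) \<in> prefractal_region n"
        by (intro stem_and_bar_in_region(2) [OF a]) auto
    qed (use y x3_def in auto)
    moreover have "2 * (x3 - p) \<notin> dyadic"
    proof
      have p_dy: "p \<in> dyadic" using p(1) dyadic_minus [of 1] by auto
      assume "2 * (x3 - p) \<in> dyadic"
      from dyadic_mult [OF dyadic_half_power [of 1] this] have "x3 - p \<in> dyadic" by (simp add: diff_divide_distrib)
      from dyadic_add [OF this p_dy] have "x3 \<in> dyadic" by simp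
      moreover have "\<sigma> * real c * 3 \<in> dyadic" using \<sigma> by (intro sign_mult_dyadic) auto
      ultimately have "x3 - \<sigma> * real c * 3 \<in> dyadic" by (rule dyadic_diff)
      then show False using gen by (simp add: x3_def algebra_simps)
    qed
    moreover have "b \<in> base_points (Suc k)"
      unfolding base_points_Suc_iff b_def using a p(1) by blast
    ultimately show ?thesis
      using child [of b "2 * (x3 - p)"] p reg unfolding eq by auto
  qed
qed

text \<open>
  From a wall the trajectory may pass from the stem to the bar and from there to the next T-shape, but
  not further, since it cannot cross the stem of the latter without hitting a wall.  So the level
  increases by at most one from one vertex to the next.
\<close>

theorem next_side:
  assumes "climbs c k z \<sigma>" and c: "c mod 4 = 2"
  obtains k' z' where "k' = k \<or> k' = Suc k" "flies c k' \<sigma> z z'" "climbs_off_side c k' z' (- \<sigma>)"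
proof -
  note found = that
  have "c > 0" "real c \<ge> 2"
  proof -
    have "c \<noteq> 0" "c \<noteq> 1" using c by auto
    then have "c \<ge> 2" by simp
    then show "c > 0" "real c \<ge> 2" by simp_all
  qed
  obtain a x y where \<sigma>: "\<sigma> \<in> {-1, 1}" and a: "a \<in> base_points k" and z: "z = loc k a x y"
    and gen: "x - \<sigma> * real c * y \<notin> dyadic" and pos: "in_stem x y \<sigma> \<or> in_bar c x y \<sigma>"
    using assms(1) unfolding climbs_def by blast
  have from_bar: thesis
    if x: "x - \<sigma> * real c * y \<notin> dyadic" "in_bar c x y \<sigma>"
      and z: "z = loc k a x y \<or> flies c k \<sigma> z (loc k a x y) \<and> (\<forall>n\<ge>k. loc k a x y \<in> prefractal_region n)" for x y
  proof -
    have join: "flies c k' \<sigma> z w" if "flies c k' \<sigma> (loc k a x y) w" "k \<le> k'" for w k'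
      using z that flies_trans [of c k' \<sigma> z "loc k a x y" w] flies_mono [of c k \<sigma> z _ k'] by auto
    show thesis
    proof (rule bar_flight [OF a \<sigma> x \<open>c > 0\<close>])
      fix z' assume "flies c k \<sigma> (loc k a x y) z'" "climbs_off_side c k z' (- \<sigma>)"
      then show thesis using found [of k z'] join by simp
    next
      fix b x' assume b: "b \<in> base_points (Suc k)" and x': "0 < x'" "x' < 2" "x' \<notin> dyadic"
        and fl: "flies c (Suc k) \<sigma> (loc k a x y) (loc (Suc k) b x' 0)"
        and reg: "\<And>n. Suc k \<le> n \<Longrightarrow> loc (Suc k) b x' 0 \<in> prefractal_region n"
      have gen': "x' - \<sigma> * real c * 0 \<notin> dyadic" and "in_stem x' 0 \<sigma>"
        using x' \<sigma> by (auto simp: in_stem_def)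
      then show thesis
      proof (rule stem_flight [OF b \<sigma> _ _ \<open>c > 0\<close>])
        fix z' assume z': "flies c (Suc k) \<sigma> (loc (Suc k) b x' 0) z'" "climbs_off_side c (Suc k) z' (- \<sigma>)"
        have "flies c (Suc k) \<sigma> z z'"
          using flies_trans [OF join [OF fl] z'(1) reg] by simp
        with z'(2) show thesis using found [of "Suc k" z'] by simp
      next
        assume "0 + 2 / real c > 2"
        moreover have "2 / real c \<le> 2 / 2" using \<open>real c \<ge> 2\<close> by (intro divide_left_mono) auto
        ultimately show thesis by simp
      qed
    qed
  qed
  show thesis
  proof (cases "in_stem x y \<sigma>")
    case True
    show thesis
    proof (rule stem_flight [OF a \<sigma> gen True \<open>c > 0\<close>])
      fix z' assume "flies c k \<sigma> (loc k a x y) z'" "climbs_off_side c k z' (- \<sigma>)"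
      then show thesis using found [of k z'] z by simp
    next
      fix x' assume x': "0 < x'" "x' < 2" and fl: "flies c k \<sigma> (loc k a x y) (loc k a x' 2)"
        and gen': "x' - \<sigma> * real c * 2 \<notin> dyadic"
      have "\<forall>n\<ge>k. loc k a x' 2 \<in> prefractal_region n"
        using stem_and_bar_in_region(1) [OF a] x' by auto
      then show thesis using from_bar [OF gen' bar_entry [OF c \<sigma> x']] fl z by simp
    qed
  next
    case False
    then show thesis using from_bar [OF gen] pos z by blast
  qed
qed

section \<open>The path to an elusive point\<close>

lemma heights_closed_region:
  assumes "w \<in> closed_region n" shows "0 \<le> Im w" "Im w \<le> 6 - 3 * (1/2) ^ n"
proof -
  obtain k b where b: "k \<le> n" "b \<in> base_points k" "w \<in> tshape b ((1/2) ^ k)"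
    using assms unfolding closed_region_def by blast
  have *: "6 - 6 * (1/2) ^ k \<le> Im w" "Im w \<le> 6 - 3 * (1/2) ^ k"
    using b(3) Im_base_point [OF b(2)] by (auto simp: in_tshape_iff)
  have "(1/2::real) ^ k \<le> 1" "(1/2::real) ^ n \<le> (1/2) ^ k"
    using b(1) by (simp_all add: power_le_one power_decreasing)
  with * show "0 \<le> Im w" "Im w \<le> 6 - 3 * (1/2) ^ n" by linarith+
qed

text \<open>
  The base of the first T-shape stays on the boundary because nothing lies below height \<open>0\<close>.
\<close>

lemma initial_side:
  assumes "0 < t" "t < 2" shows "Complex t 0 \<in> prefractal n"
proof -
  have loc: "Complex t 0 = loc 0 0 t 0" by (simp add: loc_def complex_eq_iff)
  have "Complex t 0 \<in> tshape 0 ((1/2) ^ 0)" using assms unfolding loc loc_in_tshape by simp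
  then have "Complex t 0 \<in> closed_region n" using tshape_subset_closed_region [of 0 0 n] by auto
  moreover have "Complex t 0 \<notin> prefractal_region n"
  proof
    assume "Complex t 0 \<in> prefractal_region n"
    then obtain e where "e > 0" and e: "ball (Complex t 0) e \<subseteq> closed_region n"
      unfolding prefractal_region_def mem_interior by blast
    have "dist (Complex t 0) (Complex t (- (e/2))) < e"
      using \<open>e > 0\<close> by (simp add: dist_norm cmod_def)
    then have "Complex t (- (e/2)) \<in> closed_region n" using e by auto
    from heights_closed_region(1) [OF this] \<open>e > 0\<close> show False by simp
  qed
  ultimately show ?thesis by (simp add: prefractal_iff)
qed

lemma initial_inward:
  assumes "0 < t" "t < 2" "r > 0"
  shows "inward n (Complex t 0) (r *\<^sub>R heading c \<sigma>)"
proof -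
  define d where "d = min t (2 - t) / (\<bar>\<sigma>\<bar> * c + 1)"
  have pos: "\<bar>\<sigma>\<bar> * c + 1 > 0" by (simp add: add_nonneg_pos)
  have "d > 0" using assms pos by (simp add: d_def)
  show ?thesis unfolding inward_def
  proof (intro exI [of _ "min d 1 / r"] conjI allI impI)
    show "min d 1 / r > 0" using \<open>d > 0\<close> \<open>r > 0\<close> by simp
    fix s assume s: "0 < s \<and> s < min d 1 / r"
    define q where "q = s * r"
    have q: "0 < q" "q < d" "q < 1" using s \<open>r > 0\<close> by (auto simp: q_def pos_less_divide_eq)
    have "q * (\<bar>\<sigma>\<bar> * c + 1) < min t (2 - t)" using q(2) pos by (simp add: d_def pos_less_divide_eq)
    moreover have "\<bar>q * (\<sigma> * c)\<bar> \<le> q * (\<bar>\<sigma>\<bar> * c + 1)"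
      using q(1) by (simp add: abs_mult algebra_simps)
    ultimately have "0 < t + q * (\<sigma> * c)" "t + q * (\<sigma> * c) < 2" by (auto simp: abs_le_iff)
    then have "loc 0 0 (t + q * (\<sigma> * c)) q \<in> prefractal_region n"
      using q by (intro stem_and_bar_in_region(1)) auto
    moreover have "loc 0 0 (t + q * (\<sigma> * c)) q = Complex t 0 + s *\<^sub>R r *\<^sub>R heading c \<sigma>"
      by (simp add: complex_eq_iff heading_def q_def)
    ultimately show "Complex t 0 + s *\<^sub>R r *\<^sub>R heading c \<sigma> \<in> prefractal_region n" by simp
  qed
qed

text \<open>
  The sequence of vertices of a climbing trajectory that starts on the base with horizontal direction
  \<open>\<sigma>\<close>; \<open>K j\<close> is the level of the T-shape to whose boundary \<open>v j\<close> belongs.  All vertices but the first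
  lie on vertical sides, so the horizontal direction alternates.
\<close>

locale climbing_path =
  fixes c :: nat and \<sigma> :: real and K :: "nat \<Rightarrow> nat" and v :: "nat \<Rightarrow> complex"
  assumes c_pos: "c > 0" and sign: "\<sigma> \<in> {-1, 1}"
    and level_le: "K j \<le> j" and level_mono: "K j \<le> K (Suc j)"
    and on_side: "K j \<le> n \<Longrightarrow> v j \<in> prefractal n"
    and height: "6 - 6 * (1/2) ^ K j \<le> Im (v j)"
    and flight: "flies c (K (Suc j)) (\<sigma> * (-1) ^ j) (v j) (v (Suc j))"
    and start: "Im (v 0) = 0" "Re (v 0) \<notin> dyadic"
    and off_dyadic: "Im (v (Suc j)) \<notin> dyadic"
begin

definition \<sigma>' :: "nat \<Rightarrow> real" where "\<sigma>' j = \<sigma> * (-1) ^ j"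

lemma \<sigma>': "\<sigma>' j \<in> {-1, 1}" "\<bar>\<sigma>' j\<bar> = 1" "\<sigma>' (Suc j) = - \<sigma>' j"
proof -
  show "\<sigma>' (Suc j) = - \<sigma>' j" for j by (simp add: \<sigma>'_def)
  then show "\<sigma>' j \<in> {-1, 1}" for j by (induction j) (use sign in \<open>auto simp: \<sigma>'_def\<close>)
  from this [of j] show "\<bar>\<sigma>' j\<bar> = 1" by auto
qed

definition T :: "nat \<Rightarrow> real" where "T j = Im (v (Suc j)) - Im (v j)"

lemma step:
  shows T_pos: "T j > 0" and v_Suc: "v (Suc j) = v j + T j *\<^sub>R heading c (\<sigma>' j)"
    and segment: "K (Suc j) \<le> n \<Longrightarrow> 0 < t \<Longrightarrow> t < T j \<Longrightarrow> v j + t *\<^sub>R heading c (\<sigma>' j) \<in> prefractal_region n"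
proof -
  obtain T' where T': "T' > 0" "v (Suc j) = v j + T' *\<^sub>R heading c (\<sigma>' j)"
    "\<And>n t. K (Suc j) \<le> n \<Longrightarrow> 0 < t \<Longrightarrow> t < T' \<Longrightarrow> v j + t *\<^sub>R heading c (\<sigma>' j) \<in> prefractal_region n"
    using flight [of j] unfolding flies_def \<sigma>'_def by blast
  have "T j = T'" unfolding T_def T'(2) by (simp add: heading_def)
  with T' show "T j > 0" "v (Suc j) = v j + T j *\<^sub>R heading c (\<sigma>' j)"
    "K (Suc j) \<le> n \<Longrightarrow> 0 < t \<Longrightarrow> t < T j \<Longrightarrow> v j + t *\<^sub>R heading c (\<sigma>' j) \<in> prefractal_region n"
    by auto
qed

lemma Re_Suc: "Re (v (Suc j)) = Re (v j) + \<sigma>' j * c * T j"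
  unfolding v_Suc by (simp add: heading_def)

lemma vertical_side: "v (Suc j) \<in> prefractal n \<Longrightarrow> Re (v (Suc j)) \<in> grid n \<and> has_tangent (prefractal n) (v (Suc j)) \<i>"
  using prefractal_vertical_side [of "v (Suc j)" n] off_dyadic [of j] grid_dyadic [of n] by blast

lemma has_tangent_at_vertex:
  assumes "v j \<in> prefractal n" shows "\<exists>d. has_tangent (prefractal n) (v j) d"
proof (cases j)
  case 0
  then show ?thesis
    using prefractal_horizontal_side(2) [of "v 0" n] start(2) grid_dyadic [of n] assms by blast
next
  case (Suc i)
  then show ?thesis using vertical_side assms by blast
qed

lemma Im_mono: "incseq (\<lambda>j. Im (v j))"
  using T_pos unfolding T_def by (intro incseq_SucI) (simp add: less_imp_le)

lemma Im_less_6: "Im (v j) < 6"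
proof -
  have "Im (v j) \<le> 6 - 3 * (1/2) ^ K j"
    using on_side [of j "K j"] prefractal_subset heights_closed_region(2) by blast
  then show ?thesis by (simp add: le_less_trans)
qed

text \<open>
  If all levels were at most \<open>M\<close>, the abscissas of all vertices but the first would be multiples of
  \<open>(1/2) ^ M\<close>.  Consecutive ones are different, so each flight would cover at least that horizontal
  distance and gain at least the height \<open>\<delta>\<close>; but all heights are less than \<open>6\<close>.
\<close>

lemma levels_unbounded: "\<exists>j. M \<le> K j"
proof (rule ccontr)
  assume "\<not> ?thesis"
  then have K: "K j \<le> M" for j by (meson linear)
  define \<delta> :: real where "\<delta> = (1/2) ^ M / c"
  have "\<delta> > 0" using c_pos by (simp add: \<delta>_def)
  have gain: "\<delta> \<le> T (Suc j)" for j
  proof -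
    obtain p q where p: "Re (v (Suc (Suc j))) = (1/2) ^ M * of_int p" and q: "Re (v (Suc j)) = (1/2) ^ M * of_int q"
      using vertical_side [OF on_side [OF K]] unfolding grid_def by blast
    have "(1/2) ^ M * \<bar>real_of_int (p - q)\<bar> = \<bar>Re (v (Suc (Suc j))) - Re (v (Suc j))\<bar>"
      unfolding p q by (simp add: abs_mult flip: right_diff_distrib)
    also have "\<dots> = c * T (Suc j)"
      using T_pos [of "Suc j"] by (simp add: Re_Suc [of "Suc j"] abs_mult \<sigma>')
    finally have eq: "(1/2) ^ M * \<bar>real_of_int (p - q)\<bar> = c * T (Suc j)" .
    have "c * T (Suc j) > 0" using c_pos T_pos by simp
    then have "p \<noteq> q" using eq by auto
    then have "\<bar>real_of_int (p - q)\<bar> \<ge> 1" by linarith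
    then have "(1/2) ^ M * 1 \<le> (1/2::real) ^ M * \<bar>real_of_int (p - q)\<bar>" by (intro mult_left_mono) auto
    then show ?thesis unfolding eq \<delta>_def using c_pos by (simp add: pos_divide_le_eq mult.commute)
  qed
  have "Im (v (Suc j)) \<ge> j * \<delta>" for j
  proof (induction j)
    case 0
    show ?case using incseqD [OF Im_mono, of 0 "Suc 0"] start(1) by simp
  next
    case (Suc j)
    then show ?case using gain [of j] by (simp add: T_def algebra_simps)
  qed
  moreover obtain j :: nat where "6 < j * \<delta>" using \<open>\<delta> > 0\<close> reals_Archimedean3 by blast
  ultimately show False using Im_less_6 [of "Suc j"] by (meson less_trans not_less)
qed

lemma Im_tendsto: "(\<lambda>j. Im (v j)) \<longlonglongrightarrow> 6"
proof (rule LIMSEQ_I)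
  fix e :: real assume "e > 0"
  obtain M where M: "(1/2::real) ^ M < e / 6" using \<open>e > 0\<close> real_arch_pow_inv [of "e/6" "1/2"] by auto
  obtain j0 where j0: "M \<le> K j0" using levels_unbounded by blast
  have "norm (Im (v j) - 6) < e" if "j0 \<le> j" for j
  proof -
    have "K j0 \<le> K j" using lift_Suc_mono_le [of K, OF level_mono that] .
    then have "(1/2::real) ^ K j \<le> (1/2) ^ M" using j0 by (intro power_decreasing) auto
    moreover have "\<bar>Im (v j) - 6\<bar> = 6 - Im (v j)" using Im_less_6 [of j] by simp
    ultimately show ?thesis unfolding real_norm_def using height [of j] M by linarith
  qed
  then show "\<exists>no. \<forall>n\<ge>no. norm (Im (v n) - 6) < e" by blast
qed

text \<open>
  The abscissas converge because the path is Lipschitz over its height: the sequences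
  \<open>c * Im (v j) \<plusminus> Re (v j)\<close> are nondecreasing and bounded.
\<close>

lemma converges_to_elusive: "\<exists>z. elusive_point z \<and> v \<longlonglongrightarrow> z"
proof -
  define p q where "p j = c * Im (v j) + Re (v j)" and "q j = c * Im (v j) - Re (v j)" for j
  have inc: "incseq p" "incseq q"
  proof -
    have gain: "p (Suc j) - p j = c * T j * (1 + \<sigma>' j)" "q (Suc j) - q j = c * T j * (1 - \<sigma>' j)" for j
      by (simp_all add: p_def q_def Re_Suc T_def algebra_simps)
    have nonneg: "c * T j * (1 + \<sigma>' j) \<ge> 0" "c * T j * (1 - \<sigma>' j) \<ge> 0" for j
      using \<sigma>'(1) [of j] T_pos [of j] by (auto simp: zero_le_mult_iff)
    have "p j \<le> p (Suc j)" "q j \<le> q (Suc j)" for j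
      using gain [of j] nonneg [of j] by linarith+
    then show "incseq p" "incseq q" by (auto intro: incseq_SucI)
  qed
  have "p j \<le> 12 * real c - q 0" for j
  proof -
    have "q 0 \<le> q j" using incseqD [OF inc(2)] by simp
    moreover have "real c * Im (v j) \<le> real c * 6" using Im_less_6 [of j] by (intro mult_left_mono) auto
    ultimately show ?thesis unfolding p_def q_def by linarith
  qed
  then obtain L where "p \<longlonglongrightarrow> L" using incseq_convergent [OF inc(1)] by metis
  then have "(\<lambda>j. p j - real c * Im (v j)) \<longlonglongrightarrow> L - real c * 6" by (intro tendsto_intros Im_tendsto)
  then have "(\<lambda>j. Re (v j)) \<longlonglongrightarrow> L - real c * 6" by (simp add: p_def)
  then have lim: "v \<longlonglongrightarrow> Complex (L - real c * 6) 6" (is "_ \<longlonglongrightarrow> ?z")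
    using Im_tendsto by (simp add: tendsto_complex_iff)
  have "?z \<in> T_fractal"
    unfolding T_fractal_def using lim on_side level_le by blast
  moreover have "?z \<notin> prefractal n" for n
  proof
    assume "?z \<in> prefractal n"
    then have "6 \<le> 6 - 3 * (1/2::real) ^ n"
      using prefractal_subset heights_closed_region(2) [of ?z n] by auto
    moreover have "(0::real) < (1/2) ^ n" by simp
    ultimately show False by linarith
  qed
  ultimately show ?thesis using lim unfolding elusive_point_def by blast
qed

lemma vertices_smooth: "smooth_fractal_point (v j)"
proof -
  have "v j \<in> T_fractal"
    unfolding T_fractal_def
  proof (intro CollectI exI conjI allI)
    fix n show "(if K j \<le> n then v j else v 0) \<in> prefractal n"
      using on_side [of j n] on_side [of 0 n] level_le [of 0] by simp
  next
    show "(\<lambda>n. if K j \<le> n then v j else v 0) \<longlonglongrightarrow> v j"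
      by (rule tendsto_eventually) (auto simp: eventually_at_top_linorder)
  qed
  then show ?thesis
    unfolding smooth_fractal_point_def using on_side has_tangent_at_vertex by blast
qed

text \<open>
  At the vertical side through \<open>v (Suc k)\<close> the directions to the two neighbouring vertices are mirror
  images in the horizontal line through that point, so measured against \<open>\<i>\<close> and \<open>- \<i>\<close> their angles are equal.
\<close>

lemma nontrivial: "nontrivial_path v"
  unfolding nontrivial_path_def Let_def
proof (intro conjI allI)
  fix k
  show "v k \<noteq> v (Suc k)" using T_pos [of k] by (auto simp: T_def)
  show "open_segment (v k) (v (Suc k)) \<subseteq> T_region"
    using open_segment_ray [OF T_pos [of k], of _ "v k" "heading c (\<sigma>' k)"] segment [of k "K (Suc k)"]
    unfolding T_region_def v_Suc by blast
  show "smooth_fractal_point (v k)" by (rule vertices_smooth)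
  define z where "z = v (Suc k)"
  have "z \<in> prefractal (LEAST n. z \<in> prefractal n)"
    using on_side [of "Suc k" "K (Suc k)"] unfolding z_def by (intro LeastI) simp
  then have tangent: "has_tangent (prefractal (LEAST n. z \<in> prefractal n)) z \<i>"
    using vertical_side z_def by blast
  have arriving: "v k - z = - T k *\<^sub>R heading c (\<sigma>' k)"
    unfolding z_def v_Suc by simp
  have leaving: "v (Suc (Suc k)) - z = T (Suc k) *\<^sub>R heading c (- \<sigma>' k)"
    unfolding z_def v_Suc [of "Suc k"] by (simp add: \<sigma>')
  have "norm (heading c (- \<sigma>' k)) = norm (heading c (\<sigma>' k))"
    by (simp add: heading_def cmod_def)
  then have "angle_between (v k - z) \<i> = angle_between (v (Suc (Suc k)) - z) (- \<i>)"
    unfolding angle_between_def arriving leaving using T_pos [of k] T_pos [of "Suc k"]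
    by (simp add: inner_complex_def heading_def)
  with tangent show "\<exists>d. has_tangent (prefractal (LEAST n. v (Suc k) \<in> prefractal n)) (v (Suc k)) d \<and>
      angle_between (v k - v (Suc k)) d = angle_between (v (Suc (Suc k)) - v (Suc k)) (- d)"
    unfolding z_def by blast
qed

text \<open>
  The first \<open>j\<close> segments of the path have level at most \<open>j \<le> n\<close>, so they belong to the orbit in
  \<^term>\<open>prefractal_region n\<close>.
\<close>

lemma orbit:
  assumes "r > 0"
  shows "j \<le> n \<Longrightarrow> (billiard_step n ^^ j) (v 0, r *\<^sub>R heading c \<sigma>) (v j, r *\<^sub>R heading c (\<sigma>' j))"
proof (induction j)
  case 0
  show ?case by (simp add: \<sigma>'_def)
next
  case (Suc j)
  have K: "K (Suc j) \<le> n" using level_le [of "Suc j"] Suc.prems by simp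
  have "v (Suc j) = v j + (T j / r) *\<^sub>R (r *\<^sub>R heading c (\<sigma>' j))" "T j / r > 0"
    using v_Suc [of j] T_pos [of j] \<open>r > 0\<close> by simp_all
  moreover have "open_segment (v j) (v (Suc j)) \<subseteq> prefractal_region n"
    using open_segment_ray [OF T_pos [of j], of _ "v j" "heading c (\<sigma>' j)"] segment [OF K]
    unfolding v_Suc by blast
  moreover have side: "v (Suc j) \<in> prefractal n" using on_side [OF K] .
  moreover have "reflects n (v (Suc j)) (r *\<^sub>R heading c (\<sigma>' j)) (r *\<^sub>R heading c (\<sigma>' (Suc j)))"
  proof -
    have "has_tangent (prefractal n) (v (Suc j)) \<i>" using vertical_side [OF side] by blast
    moreover have "(2 * ((r *\<^sub>R heading c (\<sigma>' j)) \<bullet> \<i>)) *\<^sub>R \<i> - r *\<^sub>R heading c (\<sigma>' j) = r *\<^sub>R heading c (\<sigma>' (Suc j))"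
      by (simp add: \<sigma>' heading_def inner_complex_def complex_eq_iff)
    ultimately show ?thesis using reflects.side by metis
  qed
  ultimately have "billiard_step n (v j, r *\<^sub>R heading c (\<sigma>' j)) (v (Suc j), r *\<^sub>R heading c (\<sigma>' (Suc j)))"
    unfolding billiard_step_def by blast
  with Suc show ?case by (meson Suc_leD relpowp_Suc_I)
qed

text \<open>
  Near its starting point the path consists of its first segment only.  This distinguishes the
  two paths that start in mirror directions.
\<close>

lemma trace_below_first_vertex:
  assumes "w \<in> path_trace v" "Im w < Im (v 1)"
  shows "w = v 0 + Im w *\<^sub>R heading c \<sigma>"
proof -
  obtain k where "w \<in> closed_segment (v k) (v (Suc k))" using assms(1) unfolding path_trace_def by blast
  then obtain u where u: "0 \<le> u" "u \<le> 1" "w = (1 - u) *\<^sub>R v k + u *\<^sub>R v (Suc k)" by (auto simp: in_segment)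
  then have w: "w = v k + (u * T k) *\<^sub>R heading c (\<sigma>' k)" by (simp add: v_Suc algebra_simps)
  then have Im: "Im w = Im (v k) + u * T k" by (simp add: heading_def)
  have "k = 0"
  proof (rule ccontr)
    assume "k \<noteq> 0"
    then have "Im (v 1) \<le> Im (v k)" using incseqD [OF Im_mono, of 1 k] by simp
    moreover have "u * T k \<ge> 0" using u(1) T_pos [of k] by simp
    ultimately show False using Im assms(2) by linarith
  qed
  with w Im start(1) show ?thesis by (simp add: \<sigma>'_def)
qed

lemma trace_first_segment:
  assumes "0 \<le> t" "t \<le> Im (v 1)" shows "v 0 + t *\<^sub>R heading c \<sigma> \<in> path_trace v"
proof -
  have T: "T 0 = Im (v 1)" by (simp add: T_def start(1))
  have "v 0 + t *\<^sub>R heading c \<sigma> = (1 - t / T 0) *\<^sub>R v 0 + (t / T 0) *\<^sub>R v (Suc 0)"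
    using T_pos [of 0] by (simp add: v_Suc \<sigma>'_def algebra_simps)
  moreover have "0 \<le> t / T 0" "t / T 0 \<le> 1" using assms T_pos [of 0] T by simp_all
  ultimately have "v 0 + t *\<^sub>R heading c \<sigma> \<in> closed_segment (v 0) (v (Suc 0))"
    unfolding in_segment by blast
  then show ?thesis unfolding path_trace_def by blast
qed

end

text \<open>
  Repeated use of \<open>next_side\<close>, which gives some next vertex, by dependent choice of the pairs of a
  level and a vertex.
\<close>

lemma climbing_path_exists:
  assumes c: "c mod 4 = 2" and t: "0 < t" "t < 2" "t \<notin> dyadic" and \<sigma>: "\<sigma> \<in> {-1, 1}"
  obtains K v where "climbing_path c \<sigma> K v" "v 0 = Complex t 0"
proof -
  define P where "P j s \<longleftrightarrow> climbs c (fst s) (snd s) (\<sigma> * (-1) ^ j) \<and> fst s \<le> j \<and>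
    (\<forall>n\<ge>fst s. snd s \<in> prefractal n) \<and> (if j = 0 then snd s = Complex t 0 else Im (snd s) \<notin> dyadic)"
    for j and s :: "nat \<times> complex"
  define Q where "Q j s s' \<longleftrightarrow> fst s \<le> fst s' \<and> flies c (fst s') (\<sigma> * (-1) ^ j) (snd s) (snd s')"
    for j :: nat and s s' :: "nat \<times> complex"
  have "P 0 (0, Complex t 0)"
  proof -
    have "Complex t 0 = loc 0 0 t 0" by (simp add: loc_def)
    moreover have "in_stem t 0 \<sigma>" using t \<sigma> by (auto simp: in_stem_def)
    ultimately have "climbs c 0 (Complex t 0) \<sigma>"
      unfolding climbs_def using \<sigma> t(3) by (intro conjI bexI [of _ 0] exI) auto
    then show ?thesis using initial_side [OF t(1,2)] by (simp add: P_def)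
  qed
  moreover have "\<exists>s'. P (Suc j) s' \<and> Q j s s'" if "P j s" for j s
  proof -
    have "climbs c (fst s) (snd s) (\<sigma> * (-1) ^ j)" using that by (simp add: P_def)
    then obtain k' z' where k': "k' = fst s \<or> k' = Suc (fst s)"
      and z': "flies c k' (\<sigma> * (-1) ^ j) (snd s) z'" "climbs_off_side c k' z' (- (\<sigma> * (-1) ^ j))"
      using next_side [OF _ c] by metis
    then have "P (Suc j) (k', z')" "Q j s (k', z')"
      using that by (auto simp: P_def Q_def climbs_off_side_def)
    then show ?thesis by blast
  qed
  ultimately obtain f where f: "\<And>j. P j (f j)" "\<And>j. Q j (f j) (f (Suc j))"
    using dependent_nat_choice [of P Q] by metis
  have height: "6 - 6 * (1/2) ^ k \<le> Im z" if climbing: "climbs c k z s" for k z s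
  proof -
    obtain a x y where "a \<in> base_points k" "z = loc k a x y" "in_stem x y s \<or> in_bar c x y s"
      using climbing unfolding climbs_def by blast
    then show ?thesis using Im_base_point [of a k] by (auto simp: in_stem_def in_bar_def)
  qed
  have v0: "snd (f 0) = Complex t 0" using f(1) [of 0] by (simp add: P_def)
  have "climbing_path c \<sigma> (\<lambda>j. fst (f j)) (\<lambda>j. snd (f j))"
  proof
    show "c > 0" using c by (cases c) auto
    fix j n
    show "6 - 6 * (1/2) ^ fst (f j) \<le> Im (snd (f j))" using f(1) [of j] height by (auto simp: P_def)
    show "Im (snd (f (Suc j))) \<notin> dyadic" using f(1) [of "Suc j"] by (simp add: P_def)
    show "fst (f j) \<le> n \<Longrightarrow> snd (f j) \<in> prefractal n" using f(1) [of j] by (simp add: P_def)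
    show "fst (f j) \<le> j" using f(1) [of j] by (simp add: P_def)
    show "fst (f j) \<le> fst (f (Suc j))" "flies c (fst (f (Suc j))) (\<sigma> * (-1) ^ j) (snd (f j)) (snd (f (Suc j)))"
      using f(2) [of j] by (simp_all add: Q_def)
  qed (use \<sigma> v0 t in auto)
  with v0 that show ?thesis by blast
qed

text \<open>
  The same point serves as initial condition at every stage, and the vertex with index \<open>n - N\<close> is the
  basepoint chosen from the \<open>n\<close>th orbit.
\<close>

lemma yields_path:
  assumes path: "climbing_path c \<sigma> K v" and t: "0 < t" "t < 2" "t \<notin> dyadic" and v0: "v 0 = Complex t 0"
    and \<theta>: "cis \<theta> = r *\<^sub>R heading c \<sigma>" "r > 0"
  shows "yields_nontrivial_path N (Complex t 0) \<theta> (\<lambda>n. v (n - N))"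
proof -
  interpret climbing_path c \<sigma> K v by (rule path)
  have start_ok: "initial_condition n (Complex t 0) \<theta>" for n
    using initial_side [OF t(1,2)] initial_inward [OF t(1,2) \<theta>(2)]
    unfolding initial_condition_def \<theta>(1) inward_def by blast
  have "periodic_orbit n (Complex t 0) \<theta>" for n
  proof -
    have "(Complex t 0, r *\<^sub>R heading c \<sigma>) \<in> billiard_states n c r t"
      using initial_side [OF t(1,2), of n] initial_inward [OF t(1,2) \<theta>(2), of n c \<sigma>] sign
      unfolding billiard_states_def mem_Collect_eq prod.case
      by (intro conjI bexI [of _ \<sigma>] bexI [of _ 1]) (auto simp: heading_def phases_def complex_eq_iff)
    moreover have "t \<notin> grid n" using t(3) grid_dyadic by blast
    ultimately have "\<exists>m\<ge>1. (billiard_step n ^^ m) (Complex t 0, cis \<theta>) (Complex t 0, cis \<theta>)"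
      unfolding \<theta>(1) using c_pos \<theta>(2) by (rule off_grid_orbit_periodic)
    then show ?thesis using start_ok by (simp add: periodic_orbit_def)
  qed
  moreover have "compatible n (Complex t 0) \<theta> m (Complex t 0) \<theta>" if "m < n" for m n
    unfolding compatible_def using that start_ok initial_side [OF t(1,2)]
    by (auto intro!: exI [of _ 0])
  ultimately have orbits: "compatible_periodic_orbits N (\<lambda>_. Complex t 0) \<theta>"
    unfolding compatible_periodic_orbits_def by blast
  have basepoints: "is_basepoint n (Complex t 0) \<theta> (n - N) (v (n - N))" for n
    unfolding is_basepoint_def \<theta>(1) v0 [symmetric] using orbit [OF \<theta>(2), of "n - N" n] by auto
  obtain z where z: "elusive_point z" "v \<longlonglongrightarrow> z" using converges_to_elusive by blast
  show ?thesis unfolding yields_nontrivial_path_def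
  proof (intro conjI)
    show "\<exists>xs k. xs N = Complex t 0 \<and> compatible_periodic_orbits N xs \<theta> \<and>
        (\<forall>n\<ge>N. is_basepoint n (xs n) \<theta> (k n) (v (n - N)))"
      using orbits basepoints
      by (intro exI [of _ "\<lambda>_. Complex t 0"] exI [of _ "\<lambda>n. n - N"]) simp
    have "(\<lambda>n. v (n - N)) \<longlonglongrightarrow> z" by (rule LIMSEQ_offset [of _ N]) (simp add: z)
    with z(1) show "\<exists>z. elusive_point z \<and> (\<lambda>n. v (n - N)) \<longlonglongrightarrow> z" by blast
    show "nontrivial_path (\<lambda>j. v (N + j - N))" using nontrivial by simp
  qed
qed

lemma opposite_paths_differ:
  assumes "climbing_path c \<sigma> K v" "climbing_path c (- \<sigma>) K' v'" "v 0 = v' 0"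
  shows "\<not> path_trace v' \<subseteq> path_trace v"
proof
  assume sub: "path_trace v' \<subseteq> path_trace v"
  interpret A: climbing_path c \<sigma> K v by (rule assms(1))
  interpret B: climbing_path c "- \<sigma>" K' v' by (rule assms(2))
  define h where "h = min (Im (v 1)) (Im (v' 1)) / 2"
  have pos: "Im (v 1) > 0" "Im (v' 1) > 0"
    using A.T_pos [of 0] B.T_pos [of 0] A.start(1) B.start(1) by (simp_all add: A.T_def B.T_def)
  then have h: "0 < h" "h < Im (v 1)" "h \<le> Im (v' 1)" by (auto simp: h_def min_def)
  define w where "w = v' 0 + h *\<^sub>R heading c (- \<sigma>)"
  have "Im w = h" by (simp add: w_def B.start(1) heading_def)
  have "w \<in> path_trace v'" unfolding w_def using h by (intro B.trace_first_segment) auto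
  then have "w \<in> path_trace v" using sub by blast
  then have "w = v 0 + h *\<^sub>R heading c \<sigma>"
    using A.trace_below_first_vertex [of w] \<open>Im w = h\<close> h by simp
  then have "h * (\<sigma> * c) = h * (- \<sigma> * c)" using assms(3) by (simp add: w_def heading_def complex_eq_iff)
  then show False using h(1) A.c_pos A.sign by auto
qed

lemma third_not_dyadic: "1 / (3 * 2 ^ i) \<notin> dyadic"
proof
  assume "1 / (3 * 2 ^ i) \<in> dyadic"
  then obtain p :: int and n :: nat where "1 / (3 * 2 ^ i) = of_int p / (2 ^ n :: real)" by (auto simp: dyadic_def)
  then have "real_of_int (2 ^ n) = real_of_int (3 * (p * 2 ^ i))" by (simp add: field_simps)
  then have eq: "(2::int) ^ n = 3 * (p * 2 ^ i)" by (simp only: of_int_eq_iff)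
  then have "(3::int) dvd 2 ^ n" by simp
  moreover have "coprime (3::int) (2 ^ n)" by (simp add: coprime_power_right_iff)
  ultimately have "is_unit (3::int)" using coprime_common_divisor [of 3 "2 ^ n :: int" 3] by simp
  then show False by simp
qed

theorem theorem5p10:
  fixes N :: nat
  shows "\<exists>(D :: real set) (X :: complex set).
    D \<subseteq> {0..<2 * pi} \<and> countable D \<and> infinite D \<and> countable X \<and> infinite X \<and>
    (\<forall>\<theta>\<in>D. \<forall>x\<in>X.
      \<exists>v. yields_nontrivial_path N x \<theta> v \<and>
        (\<exists>v'. yields_nontrivial_path N x (pi - \<theta>) v' \<and>
              \<not> path_trace (\<lambda>j. v' (N + j)) \<subseteq> path_trace (\<lambda>j. v (N + j)) \<and>
              \<not> path_trace (\<lambda>j. v (N + j)) \<subseteq> path_trace (\<lambda>j. v' (N + j))))"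
proof -
  define slope :: "nat \<Rightarrow> real" where "slope m = 1 / real (4 * m + 2)" for m
  define D where "D = range (\<lambda>m. arctan (slope m))"
  define t :: "nat \<Rightarrow> real" where "t i = 1 / (3 * 2 ^ i)" for i
  define X where "X = range (\<lambda>i. Complex (t i) 0)"
  have slope_pos: "slope m > 0" for m by (simp add: slope_def)
  have "inj (\<lambda>m. arctan (slope m))"
    by (rule injI) (simp add: arctan_eq_iff slope_def)
  then have "infinite D" unfolding D_def by (rule range_inj_infinite)
  have "inj (\<lambda>i. Complex (t i) 0)" by (rule injI) (simp add: t_def)
  then have "infinite X" unfolding X_def by (rule range_inj_infinite)
  have "D \<subseteq> {0..<2 * pi}"
  proof
    fix \<theta> assume "\<theta> \<in> D"
    then obtain m where "\<theta> = arctan (slope m)" by (auto simp: D_def)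
    then have "0 < \<theta>" "\<theta> < pi / 2" using slope_pos [of m] arctan_ubound by auto
    then show "\<theta> \<in> {0..<2 * pi}" using pi_gt_zero by auto
  qed
  have t: "0 < t i" "t i < 2" "t i \<notin> dyadic" for i
  proof -
    show "0 < t i" by (simp add: t_def)
    have "1 \<le> (2::real) ^ i" by simp
    then have "1 < 2 * (3 * (2::real) ^ i)" by linarith
    then show "t i < 2" by (simp add: t_def pos_divide_less_eq)
    show "t i \<notin> dyadic" unfolding t_def by (rule third_not_dyadic)
  qed
  have main: "\<exists>v. yields_nontrivial_path N x \<theta> v \<and>
        (\<exists>v'. yields_nontrivial_path N x (pi - \<theta>) v' \<and>
              \<not> path_trace (\<lambda>j. v' (N + j)) \<subseteq> path_trace (\<lambda>j. v (N + j)) \<and>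
              \<not> path_trace (\<lambda>j. v (N + j)) \<subseteq> path_trace (\<lambda>j. v' (N + j)))"
    if \<theta>D: "\<theta> \<in> D" and xX: "x \<in> X" for \<theta> x
  proof -
    obtain m where \<theta>: "\<theta> = arctan (slope m)" using \<theta>D by (auto simp: D_def)
    obtain i where x: "x = Complex (t i) 0" using xX by (auto simp: X_def)
    define c where "c = 4 * m + 2"
    have c: "c mod 4 = 2" unfolding c_def by presburger
    define r where "r = sin \<theta>"
    have r: "r = slope m / sqrt (1 + (slope m)\<^sup>2)" by (simp add: r_def \<theta> sin_arctan)
    have "cos \<theta> = c * r"
      unfolding r by (simp add: \<theta> cos_arctan slope_def c_def)
    then have dir: "cis \<theta> = r *\<^sub>R heading c 1" "cis (pi - \<theta>) = r *\<^sub>R heading c (- 1)"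
      by (simp_all add: complex_eq_iff heading_def r_def)
    have "1 + (slope m)\<^sup>2 > 0" by (simp add: add_pos_nonneg)
    then have "r > 0" unfolding r using slope_pos [of m] by simp
    obtain K v where v: "climbing_path c 1 K v" "v 0 = Complex (t i) 0"
      using climbing_path_exists [OF c t, of 1] by auto
    obtain K' v' where v': "climbing_path c (- 1) K' v'" "v' 0 = Complex (t i) 0"
      using climbing_path_exists [OF c t, of "- 1"] by auto
    note yields = yields_path [OF v(1) t v(2) dir(1) \<open>r > 0\<close>] yields_path [OF v'(1) t v'(2) dir(2) \<open>r > 0\<close>]
    have "\<not> path_trace v' \<subseteq> path_trace v" "\<not> path_trace v \<subseteq> path_trace v'"
      using opposite_paths_differ [of c 1 K v K' v'] opposite_paths_differ [of c "- 1" K' v' K v] v v'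
      by simp_all
    then show ?thesis
      using yields unfolding x by (intro exI conjI) auto
  qed
  show ?thesis
  proof (intro exI [of _ D] exI [of _ X] conjI ballI)
    show "countable D" "countable X" by (simp_all add: D_def X_def)
  qed (use \<open>infinite D\<close> \<open>infinite X\<close> \<open>D \<subseteq> {0..<2 * pi}\<close> main in auto)
qed

end
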